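(* Let $\mathcal C$ be a category of two-colored partitions with $\langle\emptyset\rangle\subseteq\mathcal C\subseteq\langle X\rangle$, where $X$ is the crossing partition. Then either $\mathcal C\subsetneq\mathcal S_0$, or there exists $w\in\mathbb N_0$ with $\mathcal C=\mathcal S_w$.
   Context: A two-colored partition consists of finitely many points split into a lower and an upper row, each totally ordered left to right, each point colored white ($\circ$) or black ($\bullet$), together with a partition of the points into blocks; it is a pair partition if all blocks have two points. Operations: tensor product (horizontal juxtaposition); involution $p^*$ (swap rows); composition $pq$, defined if the upper row of $p$ and the lower row of $q$ agree in length and coloring: identify them, $pq$ has the lower row of $p$ and upper row of $q$, and remaining points share a block iff connected by a chain of blocks of $p$ and $q$. A category of partitions is a set closed under tensor product, involution and composition containing the two identity partitions (one lower, one upper point of equal color forming a block) and the two partitions with empty upper row and lower row $\bullet\circ$, resp. $\circ\bullet$, forming one block; $\langle\mathcal G\rangle$ is the smallest category containing $\mathcal G$ (so $\langle\emptyset\rangle$ is the smallest category). Cyclic order: lower row left to right, then upper row right to left, then back. Normalized color: color for lower points, inverse color for upper points. $\sigma_p(S)$ = number of points of $S$ of normalized color $\bullet$ minus number of normalized color $\circ$. $\mathcal P^{\circ\bullet}_{2,\mathrm{nb}}$: pair partitions all of whose blocks $B$ satisfy $\sigma_p(B)=0$. A sector of $p$ is a proper subset $S$ of the points which is an interval of the cyclic order whose first and last points form a block of $p$. For $w\in\mathbb N_0$, $\mathcal S_w$ is the set of $p\in\mathcal P^{\circ\bullet}_{2,\mathrm{nb}}$ with $\sigma_p(S)\in w\mathbb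 Z$ for all sectors $S$ of $p$. The crossing partition $X$ has lower row $\circ\circ$, upper row $\circ\circ$ and blocks $\{$lower 1, upper 2$\}$, $\{$lower 2, upper 1$\}$. *)

theory Defs
  imports Complex_Main "HOL-Library.Disjoint_Sets"
begin

datatype color = White | Black

fun inverse_color :: "color \<Rightarrow> color" where
  "inverse_color White = Black"
| "inverse_color Black = White"

(* Low i and Up i are the points number i, counted from 0 and from the left,
   of the lower and of the upper row. *)
datatype point = Low nat | Up nat

datatype tcpart =
  Tcpart (lower: "color list") (upper: "color list") (blocks: "point set set")

definition points :: "tcpart \<Rightarrow> point set" where
  "points p = Low ` {..<length (lower p)} \<union> Up ` {..<length (upper p)}"

(* The type tcpart also has elements whose third component is not a partition of the
   points; the two-colored partitions are the elements of this set.  There is exactly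
   one representative for each partition, so HOL equality is equality of partitions. *)
definition partitions :: "tcpart set" where
  "partitions = {p. partition_on (points p) (blocks p)}"

definition pair_partitions :: "tcpart set" where
  "pair_partitions = {p \<in> partitions. \<forall>B \<in> blocks p. card B = 2}"


fun shift_point :: "nat \<Rightarrow> nat \<Rightarrow> point \<Rightarrow> point" where
  "shift_point k l (Low i) = Low (k + i)"
| "shift_point k l (Up i) = Up (l + i)"

definition tensor :: "tcpart \<Rightarrow> tcpart \<Rightarrow> tcpart" where
  "tensor p q =
     Tcpart (lower p @ lower q) (upper p @ upper q)
       (blocks p \<union> image (shift_point (length (lower p)) (length (upper p))) ` blocks q)"

fun swap_point :: "point \<Rightarrow> point" where
  "swap_point (Low i) = Up i"
| "swap_point (Up i) = Low i"

definition involution :: "tcpart \<Rightarrow> tcpart" where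
  "involution p = Tcpart (upper p) (lower p) (image swap_point ` blocks p)"

(* The three rows of points of the stacked diagram of a composition pq: the lower row
   of p, the upper row of p identified with the lower row of q, the upper row of q. *)
datatype stack_point = Bottom nat | Middle nat | Top nat

fun in_first :: "point \<Rightarrow> stack_point" where
  "in_first (Low i) = Bottom i"
| "in_first (Up i) = Middle i"

fun in_second :: "point \<Rightarrow> stack_point" where
  "in_second (Low i) = Middle i"
| "in_second (Up i) = Top i"

fun in_stack :: "point \<Rightarrow> stack_point" where
  "in_stack (Low i) = Bottom i"
| "in_stack (Up i) = Top i"

definition linked :: "tcpart \<Rightarrow> tcpart \<Rightarrow> (stack_point \<times> stack_point) set" where
  "linked p q =
     (\<Union>B \<in> blocks p. in_first ` B \<times> in_first ` B) \<union>
     (\<Union>B \<in> blocks q. in_second ` B \<times> in_second ` B)"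

definition composable :: "tcpart \<Rightarrow> tcpart \<Rightarrow> bool" where
  "composable p q \<longleftrightarrow> upper p = lower q"

(* Only meaningful if composable p q.  The argument Tcpart _ _ {} of points only serves
   to name the points of the composition. *)
definition composition :: "tcpart \<Rightarrow> tcpart \<Rightarrow> tcpart" where
  "composition p q =
     (let A = points (Tcpart (lower p) (upper q) {}) in
      Tcpart (lower p) (upper q)
        (A // {(x, y) \<in> A \<times> A. (in_stack x, in_stack y) \<in> (linked p q)\<^sup>*}))"


definition identity_part :: "color \<Rightarrow> tcpart" where
  "identity_part c = Tcpart [c] [c] {{Low 0, Up 0}}"

definition pair_part :: "color \<Rightarrow> color \<Rightarrow> tcpart" where
  "pair_part c d = Tcpart [c, d] [] {{Low 0, Low 1}}"

definition crossing :: tcpart where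
  "crossing = Tcpart [White, White] [White, White] {{Low 0, Up 1}, {Low 1, Up 0}}"

definition category :: "tcpart set \<Rightarrow> bool" where
  "category C \<longleftrightarrow>
     C \<subseteq> partitions \<and>
     identity_part White \<in> C \<and> identity_part Black \<in> C \<and>
     pair_part Black White \<in> C \<and> pair_part White Black \<in> C \<and>
     (\<forall>p \<in> C. \<forall>q \<in> C. tensor p q \<in> C) \<and>
     (\<forall>p \<in> C. involution p \<in> C) \<and>
     (\<forall>p \<in> C. \<forall>q \<in> C. composable p q \<longrightarrow> composition p q \<in> C)"

definition generated_category :: "tcpart set \<Rightarrow> tcpart set" where
  "generated_category G = category hull G"


definition cyclic_order :: "tcpart \<Rightarrow> point list" where
  "cyclic_order p = map Low [0..<length (lower p)] @ rev (map Up [0..<length (upper p)])"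

fun normalized_color :: "tcpart \<Rightarrow> point \<Rightarrow> color" where
  "normalized_color p (Low i) = lower p ! i"
| "normalized_color p (Up i) = inverse_color (upper p ! i)"

definition color_sum :: "tcpart \<Rightarrow> point set \<Rightarrow> int" where
  "color_sum p S =
     int (card {x \<in> S. normalized_color p x = Black}) -
     int (card {x \<in> S. normalized_color p x = White})"

definition neutral_pair_partitions :: "tcpart set" where
  "neutral_pair_partitions = {p \<in> pair_partitions. \<forall>B \<in> blocks p. color_sum p B = 0}"

(* The point at distance k from the point at position i, going along the cyclic order. *)
definition cyclic_point :: "tcpart \<Rightarrow> nat \<Rightarrow> nat \<Rightarrow> point" where
  "cyclic_point p i k = cyclic_order p ! ((i + k) mod length (cyclic_order p))"

definition sector :: "tcpart \<Rightarrow> point set \<Rightarrow> bool" where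
  "sector p S \<longleftrightarrow>
     S \<subset> points p \<and>
     (\<exists>i k. i < length (cyclic_order p) \<and> k < length (cyclic_order p) \<and>
        S = cyclic_point p i ` {0..k} \<and>
        {cyclic_point p i 0, cyclic_point p i k} \<in> blocks p)"

definition sector_category :: "nat \<Rightarrow> tcpart set" where
  "sector_category w =
     {p \<in> neutral_pair_partitions. \<forall>S. sector p S \<longrightarrow> int w dvd color_sum p S}"

end

(* Labelling the points of the partitions in C by letters turns C into a congruence on words in
   letters and inverse letters, that is, into a normal subgroup N of a free group which is
   invariant under substitutions of letters; a neutral pair partition lies in C iff the
   word of an injective labelling of its blocks lies in N.  Labelling one block by x and all other points
   by z, a sector of color sum k shows that x commutes with z^k modulo N; such exponents k form
   a subgroup gZ.  If g = 0, all sectors of C have color sum 0.  If g > 0, lift the relation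
   x z^g = z^g x back to a partition in C and relabel it: x Y = Y' x modulo N for positive words Y of length g,
   where Y' does not depend on x.  Hence inverse(x) y commutes with all words whose length (counted
   with signs) is divisible by g, so in the word of a partition in the sector category of g one may
   replace the letters one after the other by a single one, and the word lies in N. *)

theory Submission
  imports Defs
begin

subsection \<open>Congruences on words in letters and inverse letters\<close>

text \<open>A related pair of words only guarantees that some compatible partition lies in C. Coarse
  labellings therefore serve to extract relations, whereas an injective labelling is needed to get
  back to a given partition. The obstacle is that a sector yields relations in x and powers of one
  letter z only, while a sector of a general partition encloses many letters. Lifting helps because
  colors and labels determine the shape of the lifted partition: the two points labelled x can only
  pair with each other, and neutrality makes every other block join the lower row to the upper one.
  Any word Y on the lower row is thus carried to the upper row by a permutation of positions in
  which x takes no part. This treats positive words of length g only. A letter y met at height k is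
  padded to the positive word z^r y z^(g - 1 - r), where r = k mod g, and arbitrary words telescope
  into such pieces. For g = 0 the only positive word of that length is empty, so no relations arise,
  and this case ends with an inclusion.\<close>

lemma inverse_color_inverse_color [simp]: "inverse_color (inverse_color c) = c"
  by (cases c) auto

lemma inverse_color_neq [simp]: "inverse_color c \<noteq> c" "c \<noteq> inverse_color c"
  by (cases c; simp)+

lemma neq_color_iff: "c \<noteq> d \<longleftrightarrow> d = inverse_color c"
  by (cases c; cases d) auto

text \<open>White stands for a letter and Black for its inverse, so the sign is opposite to that of
  \<open>color_sum\<close>. Divisibility is not affected.\<close>

fun color_sign :: "color \<Rightarrow> int" where
  "color_sign White = 1"
| "color_sign Black = -1"

lemma color_sign_inverse [simp]: "color_sign (inverse_color c) = - color_sign c"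
  by (cases c) auto

definition inv_letter :: "color \<times> 'a \<Rightarrow> color \<times> 'a" where
  "inv_letter = map_prod inverse_color id"

lemma inv_letter_simps [simp]:
  "inv_letter (c, x) = (inverse_color c, x)" "inv_letter (inv_letter a) = a"
  "fst (inv_letter a) = inverse_color (fst a)" "snd (inv_letter a) = snd a"
  by (cases a; simp add: inv_letter_def)+

definition inv_word :: "(color \<times> 'a) list \<Rightarrow> (color \<times> 'a) list" where
  "inv_word u = rev (map inv_letter u)"

lemma inv_word_simps [simp]:
  "inv_word [] = []" "inv_word (a # u) = inv_word u @ [inv_letter a]"
  "inv_word (u @ v) = inv_word v @ inv_word u" "inv_word (inv_word u) = u"
  by (simp_all add: inv_word_def rev_map comp_def)

definition height :: "(color \<times> 'a) list \<Rightarrow> int" where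
  "height u = (\<Sum>a\<leftarrow>u. color_sign (fst a))"

lemma height_simps [simp]:
  "height [] = 0" "height (a # u) = color_sign (fst a) + height u"
  "height (u @ v) = height u + height v"
  by (simp_all add: height_def)

lemma height_inv_word [simp]: "height (inv_word u) = - height u"
  by (induction u) auto

lemma height_replicate [simp]: "height (replicate n a) = int n * color_sign (fst a)"
  by (induction n) (auto simp: algebra_simps)

definition letter_power :: "'a \<Rightarrow> int \<Rightarrow> (color \<times> 'a) list" where
  "letter_power z k =
     (if 0 \<le> k then replicate (nat k) (White, z) else replicate (nat (- k)) (Black, z))"

lemma height_letter_power [simp]: "height (letter_power z k) = k"
  by (simp add: letter_power_def)

lemma set_letter_power: "snd ` set (letter_power z k) \<subseteq> {z}"
  by (auto simp: letter_power_def)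

lemma inv_word_letter_power [simp]: "inv_word (letter_power z k) = letter_power z (- k)"
  by (auto simp: letter_power_def inv_word_def)

definition conjugate :: "color \<times> 'a \<Rightarrow> (color \<times> 'a) list \<Rightarrow> (color \<times> 'a) list" where
  "conjugate a u = a # u @ [inv_letter a]"

text \<open>Modulo \<open>cong\<close> the words form a group. Words are never reduced; free
  cancellation is expressed by \<open>cong_cancel_letter\<close> alone.\<close>

locale word_congruence =
  fixes cong :: "(color \<times> 'a) list \<Rightarrow> (color \<times> 'a) list \<Rightarrow> bool"  (infix "\<approx>" 50)
  assumes cong_refl [simp, intro]: "u \<approx> u"
    and cong_sym: "u \<approx> v \<Longrightarrow> v \<approx> u"
    and cong_trans [trans]: "u \<approx> v \<Longrightarrow> v \<approx> w \<Longrightarrow> u \<approx> w"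
    and cong_append: "u \<approx> u' \<Longrightarrow> v \<approx> v' \<Longrightarrow> u @ v \<approx> u' @ v'"
    and cong_cancel_letter: "[a, inv_letter a] \<approx> []"
begin

lemma cong_middle: "v \<approx> v' \<Longrightarrow> u @ v @ w \<approx> u @ v' @ w"
  by (intro cong_append cong_refl)

lemma cong_Cons: "v \<approx> v' \<Longrightarrow> a # v \<approx> a # v'"
  using cong_append[of "[a]" "[a]" v v'] by simp

lemma cong_conjugate: "u \<approx> v \<Longrightarrow> conjugate a u \<approx> conjugate a v"
  unfolding conjugate_def by (intro cong_Cons cong_append cong_refl)

lemma cong_cancel_letter': "[inv_letter a, a] \<approx> []"
  using cong_cancel_letter[of "inv_letter a"] by simp

lemma cong_right_inverse: "u @ inv_word u \<approx> []"
proof (induction u)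
  case (Cons a u)
  have "(a # u) @ inv_word (a # u) = [a] @ (u @ inv_word u) @ [inv_letter a]" by simp
  also have "\<dots> \<approx> [a] @ [] @ [inv_letter a]" using Cons by (rule cong_middle)
  also have "\<dots> \<approx> []" using cong_cancel_letter by simp
  finally show ?case .
qed simp

lemma cong_left_inverse: "inv_word u @ u \<approx> []"
  using cong_right_inverse[of "inv_word u"] by simp

lemma cong_move_right: "u @ v \<approx> w \<Longrightarrow> u \<approx> w @ inv_word v"
proof -
  assume *: "u @ v \<approx> w"
  have "u @ [] \<approx> u @ v @ inv_word v"
    by (intro cong_append cong_refl cong_sym[OF cong_right_inverse])
  also have "\<dots> \<approx> w @ inv_word v" using cong_append[OF * cong_refl] by simp
  finally show ?thesis by simp
qed

lemma cong_move_left: "v @ u \<approx> w \<Longrightarrow> u \<approx> inv_word v @ w"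
proof -
  assume *: "v @ u \<approx> w"
  have "[] @ u \<approx> (inv_word v @ v) @ u"
    by (intro cong_append cong_refl cong_sym[OF cong_left_inverse])
  also have "\<dots> \<approx> inv_word v @ w" using cong_append[OF cong_refl *] by simp
  finally show ?thesis by simp
qed

text \<open>Conjugation: v u equals u^-1 (u v) u. Hence it does not matter where the reading of a
  cyclic word begins.\<close>

lemma cong_rotate:
  assumes "u @ v \<approx> []" shows "v @ u \<approx> []"
proof -
  have "v @ u \<approx> (inv_word u @ []) @ u"
    by (rule cong_append[OF cong_move_left[OF assms] cong_refl])
  also have "\<dots> \<approx> []" using cong_left_inverse by simp
  finally show ?thesis .
qed

lemma cong_inv_word:
  assumes "u \<approx> v" shows "inv_word u \<approx> inv_word v"
proof -
  have "[] \<approx> v @ inv_word u" using cong_move_right[of "[]" u v] assms by simp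
  from cong_move_left[OF cong_sym[OF this]] show ?thesis by simp
qed

text \<open>The letter either extends the power or cancels its first letter, depending on whether
  the signs agree.\<close>

lemma cong_letter_power_step: "(c, z) # letter_power z k \<approx> letter_power z (color_sign c + k)"
proof (cases c)
  case White
  show ?thesis
  proof (cases "k \<ge> 0")
    case True
    thus ?thesis using White by (simp add: letter_power_def nat_add_distrib)
  next
    case False
    hence "nat (- k) = Suc (nat (- k - 1))" by auto
    hence *: "letter_power z k = (Black, z) # letter_power z (1 + k)"
      using False by (auto simp: letter_power_def)
    show ?thesis using cong_append[OF cong_cancel_letter cong_refl, of "(White, z)" "letter_power z (1 + k)"]
      by (simp add: White *)
  qed
next
  case Black
  show ?thesis
  proof (cases "k > 0")
    case False
    hence "nat (1 - k) = Suc (nat (- k))" by auto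
    thus ?thesis using Black False by (auto simp: letter_power_def)
  next
    case True
    hence "nat k = Suc (nat (k - 1))" by auto
    hence *: "letter_power z k = (White, z) # letter_power z (-1 + k)"
      using True by (auto simp: letter_power_def)
    show ?thesis using cong_append[OF cong_cancel_letter cong_refl, of "(Black, z)" "letter_power z (-1 + k)"]
      by (simp add: Black *)
  qed
qed

lemma cong_letter_power_height:
  assumes "snd ` set u \<subseteq> {z}"
  shows "u \<approx> letter_power z (height u)"
  using assms
proof (induction u)
  case (Cons a u)
  then obtain c where a: "a = (c, z)" by (cases a) auto
  have "a # u \<approx> a # letter_power z (height u)"
    using Cons by (intro cong_Cons) auto
  also have "\<dots> \<approx> letter_power z (height (a # u))"
    using cong_letter_power_step by (simp add: a)
  finally show ?case .
qed (simp add: letter_power_def)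

lemma cong_single_label:
  assumes "snd ` set u \<subseteq> {z}" "snd ` set v \<subseteq> {z}" "height u = height v"
  shows "u \<approx> v"
  using cong_trans[OF cong_letter_power_height[OF assms(1)]
      cong_sym[OF cong_letter_power_height[OF assms(2), folded assms(3)]]] .

lemma cong_letter_power_add:
  assumes "k + l = m" shows "letter_power z k @ letter_power z l \<approx> letter_power z m"
proof (rule cong_single_label)
  show "snd ` set (letter_power z k @ letter_power z l) \<subseteq> {z}"
    unfolding set_append image_Un by (intro Un_least set_letter_power)
  show "snd ` set (letter_power z m) \<subseteq> {z}" by (rule set_letter_power)
  show "height (letter_power z k @ letter_power z l) = height (letter_power z m)"
    by (simp add: assms)
qed

(* That is, u commutes with inverse(x) y for all letters x and y, and for all inverse letters. *)
definition uniform :: "(color \<times> 'a) list \<Rightarrow> bool" where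
  "uniform u \<longleftrightarrow> (\<forall>a b. fst a = fst b \<longrightarrow> conjugate a u \<approx> conjugate b u)"

lemma uniformD: "uniform u \<Longrightarrow> fst a = fst b \<Longrightarrow> conjugate a u \<approx> conjugate b u"
  unfolding uniform_def by blast

lemma uniformI: "(\<And>a b. fst a = fst b \<Longrightarrow> conjugate a u \<approx> conjugate b u) \<Longrightarrow> uniform u"
  unfolding uniform_def by blast

lemma uniform_cong:
  assumes "u \<approx> v" "uniform u" shows "uniform v"
proof (rule uniformI)
  fix a b :: "color \<times> 'a" assume ab: "fst a = fst b"
  have "conjugate a v \<approx> conjugate a u" by (rule cong_conjugate[OF cong_sym[OF assms(1)]])
  also have "\<dots> \<approx> conjugate b u" by (rule uniformD[OF assms(2) ab])
  also have "\<dots> \<approx> conjugate b v" by (rule cong_conjugate[OF assms(1)])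
  finally show "conjugate a v \<approx> conjugate b v" .
qed

text \<open>The inner pair a^-1 a cancels. As conjugation by a letter is thus multiplicative, the
  uniform words are closed under products and inverses.\<close>

lemma conjugate_append: "conjugate a u @ conjugate a v \<approx> conjugate a (u @ v)"
proof -
  have "(a # u) @ [inv_letter a, a] @ (v @ [inv_letter a]) \<approx> (a # u) @ [] @ (v @ [inv_letter a])"
    by (intro cong_middle cong_cancel_letter')
  thus ?thesis by (simp add: conjugate_def)
qed

lemma uniform_Nil: "uniform []"
proof (rule uniformI)
  fix a b :: "color \<times> 'a"
  have "conjugate a [] \<approx> []" using cong_cancel_letter[of a] by (simp add: conjugate_def)
  also have "[] \<approx> conjugate b []"
    using cong_sym[OF cong_cancel_letter[of b]] by (simp add: conjugate_def)
  finally show "conjugate a [] \<approx> conjugate b []" .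
qed

lemma uniform_append:
  assumes "uniform u" "uniform v" shows "uniform (u @ v)"
proof (rule uniformI)
  fix a b :: "color \<times> 'a" assume ab: "fst a = fst b"
  have "conjugate a (u @ v) \<approx> conjugate a u @ conjugate a v"
    by (rule cong_sym[OF conjugate_append])
  also have "\<dots> \<approx> conjugate b u @ conjugate b v"
    by (rule cong_append[OF uniformD[OF assms(1) ab] uniformD[OF assms(2) ab]])
  also have "\<dots> \<approx> conjugate b (u @ v)" by (rule conjugate_append)
  finally show "conjugate a (u @ v) \<approx> conjugate b (u @ v)" .
qed

lemma uniform_inv_word:
  assumes "uniform u" shows "uniform (inv_word u)"
proof (rule uniformI)
  fix a b :: "color \<times> 'a" assume ab: "fst a = fst b"
  have "inv_word (conjugate a u) \<approx> inv_word (conjugate b u)"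
    by (rule cong_inv_word[OF uniformD[OF assms ab]])
  thus "conjugate a (inv_word u) \<approx> conjugate b (inv_word u)"
    by (simp add: conjugate_def)
qed

section \<open>Uniformity of words whose height is divisible by w\<close>

context
  fixes w :: nat
  assumes w_pos: "w > 0"
    and uniform_generators: "\<And>Y. length Y = w \<Longrightarrow> fst ` set Y \<subseteq> {White} \<Longrightarrow> uniform Y"
begin

lemma uniform_letter_power_mult: "uniform (letter_power z (k * int w))"
proof -
  have pos: "uniform (letter_power z (int n * int w))" for n
  proof (induction n)
    case 0
    show ?case using uniform_Nil by (simp add: letter_power_def)
  next
    case (Suc n)
    have "uniform (letter_power z (int w))"
      by (rule uniform_generators) (simp_all add: letter_power_def image_subset_iff)
    with Suc have "uniform (letter_power z (int w) @ letter_power z (int n * int w))"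
      by (intro uniform_append)
    moreover have "letter_power z (int w) @ letter_power z (int n * int w)
        \<approx> letter_power z (int (Suc n) * int w)"
      by (rule cong_letter_power_add) (simp add: distrib_right)
    ultimately show ?case by (rule uniform_cong[rotated])
  qed
  show ?thesis
  proof (cases k rule: int_cases2)
    case (nonneg n)
    show ?thesis unfolding nonneg by (rule pos)
  next
    case (nonpos n)
    have "uniform (letter_power z (- (int n * int w)))"
      using uniform_inv_word[OF pos[of n]] by (simp only: inv_word_letter_power)
    thus ?thesis unfolding nonpos by (simp only: mult_minus_left)
  qed
qed

text \<open>With k = q w + r the letter y is padded to z^r y z^(w - 1 - r). The uniform factors z^(q
  w) on the left and z^((- q - 1) w) on the right then restore the exponents k and - k - 1.\<close>

lemma uniform_White_step: "uniform (letter_power z k @ (White, y) # letter_power z (- k - 1))"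
proof -
  define q r where "q = k div int w" and "r = k mod int w"
  have r: "0 \<le> r" "r < int w" using w_pos by (simp_all add: r_def)
  have k: "k = q * int w + r" by (simp add: q_def r_def)
  \<comment> \<open>Both exponents are nonnegative since 0 \<le> r < w, so this is a positive word
    of length w.\<close>
  have mid: "uniform (letter_power z r @ (White, y) # letter_power z (int w - 1 - r))"
    using r by (intro uniform_generators) (auto simp: letter_power_def)
  have "uniform (letter_power z (q * int w) @
      (letter_power z r @ (White, y) # letter_power z (int w - 1 - r)) @ letter_power z ((- q - 1) * int w))"
    by (intro uniform_append mid uniform_letter_power_mult)
  hence "uniform ((letter_power z (q * int w) @ letter_power z r) @ [(White, y)] @
      (letter_power z (int w - 1 - r) @ letter_power z ((- q - 1) * int w)))"
    by simp
  moreover have "(letter_power z (q * int w) @ letter_power z r) @ [(White, y)] @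
      (letter_power z (int w - 1 - r) @ letter_power z ((- q - 1) * int w))
     \<approx> letter_power z k @ [(White, y)] @ letter_power z (- k - 1)"
    by (rule cong_append[OF _ cong_append[OF cong_refl]]; rule cong_letter_power_add)
      (simp_all add: k left_diff_distrib)
  ultimately have "uniform (letter_power z k @ [(White, y)] @ letter_power z (- k - 1))"
    by (rule uniform_cong[rotated])
  thus ?thesis by simp
qed

text \<open>For an inverse letter: z^k y^-1 z^(1 - k) is the inverse of z^(k - 1) y z^(- k).\<close>

lemma uniform_step: "uniform (letter_power z k @ a # letter_power z (- k - color_sign (fst a)))"
proof (cases a)
  case (Pair c y)
  show ?thesis
  proof (cases c)
    case White
    then show ?thesis using uniform_White_step[of z k y] by (simp add: Pair)
  next
    case Black
    then show ?thesis using uniform_inv_word[OF uniform_White_step[of z "k - 1" y]]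
      by (simp add: Pair)
  qed
qed

text \<open>Telescoping: each letter of u is enclosed by powers of z that record the heights before
  and after it, and the powers meeting between consecutive letters cancel.\<close>

lemma uniform_power_word: "uniform (letter_power z k @ u @ letter_power z (- k - height u))"
proof (induction u arbitrary: k)
  case Nil
  have "letter_power z k @ letter_power z (- k) \<approx> letter_power z (0 * int w)"
    by (intro cong_letter_power_add) simp
  hence "uniform (letter_power z k @ letter_power z (- k))"
    by (rule uniform_cong[OF cong_sym uniform_letter_power_mult])
  then show ?case by simp
next
  case (Cons a u)
  let ?k = "k + color_sign (fst a)"
  have k: "- k - color_sign (fst a) = - ?k" "- ?k - height u = - k - height (a # u)" by simp_all
  have "uniform ((letter_power z k @ a # letter_power z (- ?k)) @
      (letter_power z ?k @ u @ letter_power z (- k - height (a # u))))"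
    using uniform_step[of z k a] Cons[of ?k] unfolding k by (rule uniform_append)
  hence "uniform ((letter_power z k @ [a]) @ (letter_power z (- ?k) @ letter_power z ?k)
       @ (u @ letter_power z (- k - height (a # u))))"
    by simp
  moreover have "(letter_power z k @ [a]) @ (letter_power z (- ?k) @ letter_power z ?k)
       @ (u @ letter_power z (- k - height (a # u)))
     \<approx> (letter_power z k @ [a]) @ letter_power z 0 @ (u @ letter_power z (- k - height (a # u)))"
    by (intro cong_middle cong_letter_power_add) simp
  ultimately have "uniform ((letter_power z k @ [a]) @ letter_power z 0 @ (u @ letter_power z (- k - height (a # u))))"
    by (rule uniform_cong[rotated])
  then show ?case by (simp add: letter_power_def[of _ 0])
qed

text \<open>Padding by z^(- height u) makes any u uniform; if w divides the height, z^(height u) is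
  uniform as well and removes the padding.\<close>

lemma uniform_if_dvd_height:
  assumes "int w dvd height u" shows "uniform u"
proof -
  obtain k where k: "height u = k * int w" using assms by (metis dvdE mult.commute)
  fix z
  have "uniform ((letter_power z 0 @ u @ letter_power z (- 0 - height u)) @ letter_power z (k * int w))"
    by (intro uniform_append uniform_power_word uniform_letter_power_mult)
  hence "uniform (u @ letter_power z (- height u) @ letter_power z (k * int w))"
    by (simp add: letter_power_def[of _ 0])
  moreover have "u @ letter_power z (- height u) @ letter_power z (k * int w) \<approx> u @ letter_power z 0"
    by (intro cong_append cong_refl cong_letter_power_add) (simp add: k)
  ultimately have "uniform (u @ letter_power z 0)"
    by (rule uniform_cong[rotated])
  then show ?thesis by (simp add: letter_power_def)
qed

text \<open>The factor \<beta> enclosed by the two occurrences of x is uniform, so both occurrences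
  can be changed to z at once. After all letters are changed, a word in z of height 0 is
  left.\<close>

lemma cong_Nil_if_balanced:
  assumes "height t = 0"
    and balanced: "\<And>x. x \<in> snd ` set t \<Longrightarrow> \<exists>\<alpha> \<beta> \<gamma> c. t = \<alpha> @ conjugate (c, x) \<beta> @ \<gamma> \<and>
           x \<notin> snd ` set (\<alpha> @ \<beta> @ \<gamma>) \<and> int w dvd height \<beta>"
  shows "t \<approx> []"
proof -
  \<comment> \<open>The common letter is arbitrary and may itself occur in t.\<close>
  fix z :: 'a
  define s where "s A = map (map_prod id (\<lambda>x. if x \<in> A then z else x)) t" for A
  have "t \<approx> s A" if "finite A" for A
    using that
  proof (induction A)
    case empty
    have "map_prod id (\<lambda>x. x) = (\<lambda>a :: color \<times> 'a. a)" by auto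
    then show ?case by (simp add: s_def)
  next
    case (insert x A)
    show ?case
    proof (cases "x \<in> snd ` set t")
      case False
      hence "s (insert x A) = s A" by (force simp: s_def)
      with insert show ?thesis by simp
    next
      case True
      then obtain \<alpha> \<beta> \<gamma> c where t: "t = \<alpha> @ conjugate (c, x) \<beta> @ \<gamma>"
        and x: "x \<notin> snd ` set (\<alpha> @ \<beta> @ \<gamma>)" and dvd: "int w dvd height \<beta>"
        using balanced by blast
      define f where "f B l = map (map_prod id (\<lambda>x. if x \<in> B then z else x)) l" for B and l :: "(color \<times> 'a) list"
      have f_insert: "f (insert x A) l = f A l" if "set l \<subseteq> set (\<alpha> @ \<beta> @ \<gamma>)" for l
        using that x by (force simp: f_def)
      have height_f: "height (f B l) = height l" for B l
        by (simp add: f_def height_def comp_def)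
      have "s A = f A \<alpha> @ conjugate (c, x) (f A \<beta>) @ f A \<gamma>"
        using insert.hyps by (simp add: s_def t f_def conjugate_def)
      \<comment> \<open>Earlier replacements change labels but no colors, so the enclosed factor
        still has a height divisible by w.\<close>
      also have "\<dots> \<approx> f A \<alpha> @ conjugate (c, z) (f A \<beta>) @ f A \<gamma>"
        using uniform_if_dvd_height[of "f A \<beta>"] dvd
        by (intro cong_middle uniformD) (simp_all add: height_f)
      also have "\<dots> = f (insert x A) \<alpha> @ conjugate (c, z) (f (insert x A) \<beta>) @ f (insert x A) \<gamma>"
        by (simp add: f_insert le_supI1 le_supI2)
      also have "\<dots> = s (insert x A)"
        by (simp add: s_def t f_def conjugate_def)
      finally show ?thesis by (rule cong_trans[OF insert.IH])
    qed
  qed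
  hence "t \<approx> s (snd ` set t)" by simp
  also have "\<dots> \<approx> []"
    using assms(1) by (intro cong_single_label[of _ z]) (force simp: s_def height_def comp_def)+
  finally show ?thesis .
qed

end

end

subsection \<open>The word congruence of a category\<close>

fun word_label :: "(color \<times> 'a) list \<Rightarrow> (color \<times> 'a) list \<Rightarrow> point \<Rightarrow> 'a" where
  "word_label u v (Low i) = snd (u ! i)"
| "word_label u v (Up i) = snd (v ! i)"

definition block_labelling :: "tcpart \<Rightarrow> (point \<Rightarrow> 'a) \<Rightarrow> bool" where
  "block_labelling p f \<longleftrightarrow> (\<forall>B \<in> blocks p. \<forall>x \<in> B. \<forall>y \<in> B. f x = f y)"

lemma block_labellingI:
  "(\<And>B x y. B \<in> blocks p \<Longrightarrow> x \<in> B \<Longrightarrow> y \<in> B \<Longrightarrow> f x = f y) \<Longrightarrow> block_labelling p f"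
  unfolding block_labelling_def by blast

lemma block_labellingD:
  "block_labelling p f \<Longrightarrow> B \<in> blocks p \<Longrightarrow> x \<in> B \<Longrightarrow> y \<in> B \<Longrightarrow> f x = f y"
  unfolding block_labelling_def by blast

text \<open>Distinct blocks may carry equal labels, which makes the relation stable under
  substitution of letters and compatible with concatenation of words that share letters.\<close>

definition row_relation :: "tcpart set \<Rightarrow> (color \<times> 'a) list \<Rightarrow> (color \<times> 'a) list \<Rightarrow> bool" where
  "row_relation C u v \<longleftrightarrow>
     (\<exists>p \<in> C. lower p = map fst u \<and> upper p = map fst v \<and> block_labelling p (word_label u v))"

lemma row_relationI:
  "p \<in> C \<Longrightarrow> lower p = map fst u \<Longrightarrow> upper p = map fst v \<Longrightarrow>
    block_labelling p (word_label u v) \<Longrightarrow> row_relation C u v"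
  unfolding row_relation_def by blast

lemma row_relationE:
  assumes "row_relation C u v"
  obtains p where "p \<in> C" "lower p = map fst u" "upper p = map fst v"
    "block_labelling p (word_label u v)"
  using assms unfolding row_relation_def by blast

lemma partitions_block_subset:
  "p \<in> partitions \<Longrightarrow> B \<in> blocks p \<Longrightarrow> B \<subseteq> points p"
  by (auto simp: partitions_def partition_on_def)

lemma Low_in_points [simp]: "Low i \<in> points p \<longleftrightarrow> i < length (lower p)"
  and Up_in_points [simp]: "Up i \<in> points p \<longleftrightarrow> i < length (upper p)"
  by (auto simp: points_def)

lemma row_relation_sym:
  assumes "category C" "row_relation C u v" shows "row_relation C v u"
proof -
  obtain p where p: "p \<in> C" "lower p = map fst u" "upper p = map fst v"
    "block_labelling p (word_label u v)"
    using assms(2) by (rule row_relationE)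
  have swap: "word_label v u (swap_point x) = word_label u v x" for x
    by (cases x) auto
  have "block_labelling (involution p) (word_label v u)"
  proof (rule block_labellingI)
    fix B x y assume "B \<in> blocks (involution p)" "x \<in> B" "y \<in> B"
    then obtain B' x' y' where "B' \<in> blocks p" "x' \<in> B'" "y' \<in> B'"
      "x = swap_point x'" "y = swap_point y'"
      by (auto simp: involution_def)
    then show "word_label v u x = word_label v u y"
      using block_labellingD[OF p(4), of B' x' y'] by (simp add: swap)
  qed
  moreover have "involution p \<in> C" using assms(1) p(1) by (simp add: category_def)
  ultimately show ?thesis using p by - (rule row_relationI[of "involution p"], assumption, simp_all add: involution_def)
qed

lemma row_relation_append:
  assumes C: "category C" and "row_relation C u v" "row_relation C u' v'"
  shows "row_relation C (u @ u') (v @ v')"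
proof -
  obtain p where p: "p \<in> C" "lower p = map fst u" "upper p = map fst v"
    "block_labelling p (word_label u v)"
    using assms(2) by (rule row_relationE)
  obtain q where q: "q \<in> C" "lower q = map fst u'" "upper q = map fst v'"
    "block_labelling q (word_label u' v')"
    using assms(3) by (rule row_relationE)
  have shift: "word_label (u @ u') (v @ v') (shift_point (length u) (length v) x) = word_label u' v' x" for x
    by (cases x) auto
  have left: "word_label (u @ u') (v @ v') x = word_label u v x" if "x \<in> points p" for x
    using that p(2,3) by (cases x) (simp_all add: nth_append)
  have sub: "B \<subseteq> points p" if "B \<in> blocks p" for B
    using partitions_block_subset C p(1) that by (auto simp: category_def)
  have "block_labelling (tensor p q) (word_label (u @ u') (v @ v'))"
  proof (rule block_labellingI)
    fix B x y assume B: "B \<in> blocks (tensor p q)" and xy: "x \<in> B" "y \<in> B"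
    then consider "B \<in> blocks p" | B' where "B' \<in> blocks q" "B = shift_point (length u) (length v) ` B'"
      unfolding tensor_def p(2,3) by auto
    then show "word_label (u @ u') (v @ v') x = word_label (u @ u') (v @ v') y"
    proof cases
      case 1
      then have "x \<in> points p" "y \<in> points p" using sub xy by auto
      with block_labellingD[OF p(4) 1 xy] show ?thesis by (simp add: left)
    next
      case 2
      then obtain x' y' where "x' \<in> B'" "y' \<in> B'" "x = shift_point (length u) (length v) x'"
        "y = shift_point (length u) (length v) y'"
        using xy by blast
      with block_labellingD[OF q(4) 2(1), of x' y'] show ?thesis by (simp add: shift)
    qed
  qed
  moreover have "tensor p q \<in> C" using C p(1) q(1) by (simp add: category_def)
  ultimately show ?thesis using p q by - (rule row_relationI[of "tensor p q"], assumption, simp_all add: tensor_def)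
qed

fun stack_label :: "(color \<times> 'a) list \<Rightarrow> (color \<times> 'a) list \<Rightarrow> (color \<times> 'a) list \<Rightarrow> stack_point \<Rightarrow> 'a" where
  "stack_label u v w (Bottom i) = snd (u ! i)"
| "stack_label u v w (Middle i) = snd (v ! i)"
| "stack_label u v w (Top i) = snd (w ! i)"

lemma stack_label_simps:
  "stack_label u v w (in_first x) = word_label u v x"
  "stack_label u v w (in_second x) = word_label v w x"
  "stack_label u v w (in_stack x) = word_label u w x"
  by (cases x; simp)+

text \<open>Both partitions label the middle row by the letters of v, so labels are constant along
  every chain of blocks in the stacked diagram.\<close>

lemma row_relation_trans:
  assumes C: "category C" and "row_relation C u v" "row_relation C v w"
  shows "row_relation C u w"
proof -
  obtain p where p: "p \<in> C" "lower p = map fst u" "upper p = map fst v"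
    "block_labelling p (word_label u v)"
    using assms(2) by (rule row_relationE)
  obtain q where q: "q \<in> C" "lower q = map fst v" "upper q = map fst w"
    "block_labelling q (word_label v w)"
    using assms(3) by (rule row_relationE)
  let ?f = "stack_label u v w"
  have step: "?f s = ?f t" if "(s, t) \<in> linked p q" for s t
  proof -
    from that consider B x y where "B \<in> blocks p" "x \<in> B" "y \<in> B" "s = in_first x" "t = in_first y"
      | B x y where "B \<in> blocks q" "x \<in> B" "y \<in> B" "s = in_second x" "t = in_second y"
      unfolding linked_def by blast
    then show ?thesis
    proof cases
      case 1
      then show ?thesis using block_labellingD[OF p(4) 1(1-3)] by (simp add: stack_label_simps)
    next
      case 2
      then show ?thesis using block_labellingD[OF q(4) 2(1-3)] by (simp add: stack_label_simps)
    qed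
  qed
  have "?f s = ?f t" if "(s, t) \<in> (linked p q)\<^sup>*" for s t
    using that by induction (auto dest: step)
  hence "word_label u w x = word_label u w y" if "(in_stack x, in_stack y) \<in> (linked p q)\<^sup>*" for x y
    using that by (metis stack_label_simps(3))
  hence "block_labelling (composition p q) (word_label u w)"
    by (intro block_labellingI) (auto simp: composition_def Let_def quotient_def, metis)
  moreover have "composition p q \<in> C"
    using C p q by (simp add: category_def composable_def)
  ultimately show ?thesis
    using p q by - (rule row_relationI[of "composition p q"], assumption, simp_all add: composition_def Let_def)
qed

lemma row_relation_cancel:
  assumes "category C" shows "row_relation C [a, inv_letter a] []"
proof -
  obtain c x where a: "a = (c, x)" by (cases a)
  have "pair_part c (inverse_color c) \<in> C" using assms by (cases c) (auto simp: category_def)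
  moreover have "block_labelling (pair_part c (inverse_color c)) (word_label [a, inv_letter a] [])"
    by (intro block_labellingI) (auto simp: pair_part_def a)
  ultimately show ?thesis
    by - (rule row_relationI, assumption, simp_all add: pair_part_def a)
qed

lemma row_relation_refl:
  assumes "category C" shows "row_relation C u u"
proof (induction u)
  case Nil
  show ?case
    \<comment> \<open>The empty partition arises by composing the involution of a pair partition
      with that pair partition.\<close>
    using row_relation_trans[OF assms row_relation_sym[OF assms] ] row_relation_cancel[OF assms] by blast
next
  case (Cons a u)
  obtain c x where a: "a = (c, x)" by (cases a)
  have "identity_part c \<in> C" using assms by (cases c) (auto simp: category_def)
  moreover have "block_labelling (identity_part c) (word_label [a] [a])"
    by (intro block_labellingI) (auto simp: identity_part_def a)
  ultimately have "row_relation C [a] [a]"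
    by - (rule row_relationI, assumption, simp_all add: identity_part_def a)
  from row_relation_append[OF assms this Cons] show ?case by simp
qed

lemma word_congruence_row_relation:
  "category C \<Longrightarrow> word_congruence (row_relation C)"
  by unfold_locales (blast intro: row_relation_refl row_relation_sym row_relation_trans
      row_relation_append row_relation_cancel)+

section \<open>Words read along the rows and along the cyclic order\<close>

definition lower_word :: "tcpart \<Rightarrow> (point \<Rightarrow> 'a) \<Rightarrow> (color \<times> 'a) list" where
  "lower_word p f = map (\<lambda>i. (lower p ! i, f (Low i))) [0..<length (lower p)]"

definition upper_word :: "tcpart \<Rightarrow> (point \<Rightarrow> 'a) \<Rightarrow> (color \<times> 'a) list" where
  "upper_word p f = map (\<lambda>i. (upper p ! i, f (Up i))) [0..<length (upper p)]"

lemma map_fst_row_words: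
  "map fst (lower_word p f) = lower p" "map fst (upper_word p f) = upper p"
  by (simp_all add: lower_word_def upper_word_def comp_def map_nth)

lemma word_label_row_words:
  "x \<in> points p \<Longrightarrow> word_label (lower_word p f) (upper_word p f) x = f x"
  by (cases x) (auto simp: lower_word_def upper_word_def)

lemma block_labelling_cong:
  assumes "p \<in> partitions" "\<And>x. x \<in> points p \<Longrightarrow> f x = g x"
  shows "block_labelling p f \<longleftrightarrow> block_labelling p g"
  using partitions_block_subset[OF assms(1)] assms(2) unfolding block_labelling_def
  by (metis subsetD)

lemma row_relation_row_words_iff:
  assumes "C \<subseteq> partitions"
  shows "row_relation C (lower_word p f) (upper_word p f) \<longleftrightarrow>
    (\<exists>q \<in> C. lower q = lower p \<and> upper q = upper p \<and> block_labelling q f)"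
proof -
  have "block_labelling q (word_label (lower_word p f) (upper_word p f)) \<longleftrightarrow> block_labelling q f"
    if "q \<in> C" "lower q = lower p" "upper q = upper p" for q
  proof (rule block_labelling_cong)
    show "q \<in> partitions" using that assms by auto
    have "points q = points p" by (simp add: points_def that)
    thus "word_label (lower_word p f) (upper_word p f) x = f x" if "x \<in> points q" for x
      using word_label_row_words that by blast
  qed
  thus ?thesis by (auto simp: row_relation_def map_fst_row_words)
qed

definition cyclic_word :: "tcpart \<Rightarrow> (point \<Rightarrow> 'a) \<Rightarrow> (color \<times> 'a) list" where
  "cyclic_word p f = map (\<lambda>x. (normalized_color p x, f x)) (cyclic_order p)"

text \<open>Turning the upper row down around the right end reverses it and inverts its letters, in
  agreement with the cyclic order and the normalized colors.\<close>

lemma cyclic_word_eq: "cyclic_word p f = lower_word p f @ inv_word (upper_word p f)"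
  by (simp add: cyclic_word_def cyclic_order_def lower_word_def upper_word_def inv_word_def
      rev_map comp_def)

text \<open>The partition q may differ from p. It is forced to equal p once f separates the blocks
  of p and both are pair partitions.\<close>

lemma cyclic_word_cong_Nil_iff:
  assumes "category C"
  shows "row_relation C (cyclic_word p f) [] \<longleftrightarrow>
    (\<exists>q \<in> C. lower q = lower p \<and> upper q = upper p \<and> block_labelling q f)"
proof -
  interpret word_congruence "row_relation C" by (rule word_congruence_row_relation[OF assms])
  have "row_relation C (cyclic_word p f) [] \<longleftrightarrow> row_relation C (lower_word p f) (upper_word p f)"
  proof
    assume "row_relation C (cyclic_word p f) []"
    from cong_move_right[OF this[unfolded cyclic_word_eq]]
    show "row_relation C (lower_word p f) (upper_word p f)" by simp
  next
    assume "row_relation C (lower_word p f) (upper_word p f)"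
    from cong_trans[OF cong_append[OF this cong_refl] cong_right_inverse]
    show "row_relation C (cyclic_word p f) []" by (simp add: cyclic_word_eq)
  qed
  thus ?thesis using row_relation_row_words_iff assms by (metis category_def)
qed

subsection \<open>Neutral pair partitions form a category\<close>

lemma finite_points [simp]: "finite (points p)"
  by (simp add: points_def)

lemma color_sum_eq:
  assumes "finite S"
  shows "color_sum p S = - (\<Sum>x\<in>S. color_sign (normalized_color p x))"
proof -
  have sgn: "color_sign c = of_bool (c = White) - of_bool (c = Black)" for c
    by (cases c) auto
  have "(\<Sum>x\<in>S. color_sign (normalized_color p x)) =
      int (card (S \<inter> {x. normalized_color p x = White})) - int (card (S \<inter> {x. normalized_color p x = Black}))"
    using assms by (simp add: sgn sum_subtractf)
  thus ?thesis by (simp add: color_sum_def Int_def)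
qed

lemma neutral_blockE:
  assumes "p \<in> neutral_pair_partitions" "B \<in> blocks p"
  obtains x y where "B = {x, y}" "normalized_color p x = White" "normalized_color p y = Black"
proof -
  have B: "card B = 2" "color_sum p B = 0"
    using assms by (auto simp: neutral_pair_partitions_def pair_partitions_def)
  then obtain x y where xy: "B = {x, y}" "x \<noteq> y" by (meson card_2_iff)
  have "color_sign (normalized_color p x) + color_sign (normalized_color p y) = 0"
    using B(2) xy by (simp add: color_sum_eq)
  hence "normalized_color p x = White \<and> normalized_color p y = Black \<or>
      normalized_color p y = White \<and> normalized_color p x = Black"
    by (cases "normalized_color p x"; cases "normalized_color p y") auto
  thus thesis using that xy(1) by (auto simp: insert_commute)
qed

lemma neutral_pair_partitionsI:
  assumes "p \<in> partitions"
    and "\<And>B. B \<in> blocks p \<Longrightarrow>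
      \<exists>x y. B = {x, y} \<and> normalized_color p x = White \<and> normalized_color p y = Black"
  shows "p \<in> neutral_pair_partitions"
proof -
  have "card B = 2 \<and> color_sum p B = 0" if B: "B \<in> blocks p" for B
  proof -
    obtain x y where xy: "B = {x, y}" "normalized_color p x = White" "normalized_color p y = Black"
      using assms(2)[OF B] by blast
    hence "x \<noteq> y" by auto
    thus ?thesis using xy by (simp add: color_sum_eq)
  qed
  thus ?thesis using assms(1) by (simp add: neutral_pair_partitions_def pair_partitions_def)
qed

lemma neutral_partitions: "p \<in> neutral_pair_partitions \<Longrightarrow> p \<in> partitions"
  by (simp add: neutral_pair_partitions_def pair_partitions_def)

lemma partitions_disjoint:
  "p \<in> partitions \<Longrightarrow> B \<in> blocks p \<Longrightarrow> B' \<in> blocks p \<Longrightarrow> x \<in> B \<Longrightarrow> x \<in> B' \<Longrightarrow> B = B'"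
  by (auto simp: partitions_def partition_on_def disjoint_def)

lemma partitions_obtain_block:
  assumes "p \<in> partitions" "x \<in> points p"
  obtains B where "B \<in> blocks p" "x \<in> B"
  using assms by (auto simp: partitions_def partition_on_def)

text \<open>A saturated set of points is a union of blocks, and every block contributes 1 - 1. It
  will be applied to the part of a connected component that lies in one of two stacked
  diagrams.\<close>

lemma sum_color_sign_saturated:
  assumes p: "p \<in> neutral_pair_partitions"
    and sat: "\<And>B x y. B \<in> blocks p \<Longrightarrow> x \<in> B \<Longrightarrow> y \<in> B \<Longrightarrow> P x \<Longrightarrow> P y"
  shows "(\<Sum>x\<in>{x \<in> points p. P x}. color_sign (normalized_color p x)) = 0"
proof -
  let ?Q = "{B \<in> blocks p. \<exists>x\<in>B. P x}"
  have part: "p \<in> partitions" by (rule neutral_partitions[OF p])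
  have eq: "{x \<in> points p. P x} = \<Union>?Q"
  proof safe
    fix x assume "x \<in> points p" "P x"
    thus "x \<in> \<Union>?Q" using partitions_obtain_block[OF part] by blast
  next
    fix x y B assume "B \<in> blocks p" "x \<in> B" "y \<in> B" "P y"
    thus "x \<in> points p" "P x" using partitions_block_subset[OF part] sat by blast+
  qed
  have "finite B" if "B \<in> blocks p" for B
    using partitions_block_subset[OF part that] finite_points by (rule finite_subset)
  moreover have "B \<inter> B' = {}" if "B \<in> blocks p" "B' \<in> blocks p" "B \<noteq> B'" for B B'
    using partitions_disjoint[OF part that(1,2)] that(3) by blast
  ultimately have "(\<Sum>x\<in>{x \<in> points p. P x}. color_sign (normalized_color p x)) =
      (\<Sum>B\<in>?Q. \<Sum>x\<in>B. color_sign (normalized_color p x))"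
    unfolding eq by (subst sum.Union_disjoint) auto
  also have "\<dots> = 0"
  proof (rule sum.neutral, rule ballI)
    fix B assume "B \<in> ?Q"
    then obtain x y where "B = {x, y}" "normalized_color p x = White" "normalized_color p y = Black"
      using neutral_blockE[OF p] by blast
    thus "(\<Sum>x\<in>B. color_sign (normalized_color p x)) = 0"
      by (cases "x = y") auto
  qed
  finally show ?thesis .
qed

lemma sum_points:
  "(\<Sum>x\<in>points p. h x) = (\<Sum>i<length (lower p). h (Low i)) + (\<Sum>i<length (upper p). h (Up i))"
  unfolding points_def by (subst sum.union_disjoint) (auto simp: sum.reindex inj_on_def)

section \<open>Composition of neutral pair partitions\<close>

text \<open>With at most one edge into and one edge out of each point, a walk that reverses
  direction retraces the edge just used. Any connecting walk can thus be straightened to a directed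
  one.\<close>

lemma connected_single_valued:
  assumes "(s, t) \<in> (R \<union> R\<inverse>)\<^sup>*" and R: "single_valued R" "single_valued (R\<inverse>)"
  shows "(s, t) \<in> R\<^sup>* \<or> (t, s) \<in> R\<^sup>*"
  using assms(1)
proof induction
  case (step t t')
  have det: "t1 = t2" if "(t, t1) \<in> R" "(t, t2) \<in> R" for t1 t2
    using that R(1) by (auto dest: single_valuedD)
  have codet: "t1 = t2" if "(t1, t) \<in> R" "(t2, t) \<in> R" for t1 t2
    using that R(2) by (auto dest: single_valuedD)
  from step.hyps(2) consider "(t, t') \<in> R" | "(t', t) \<in> R" by auto
  then show ?case
  proof cases
    case 1
    from step.IH show ?thesis
    proof
      assume "(s, t) \<in> R\<^sup>*"
      then show ?thesis using 1 by (meson rtrancl.rtrancl_into_rtrancl)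
    next
      assume "(t, s) \<in> R\<^sup>*"
      then show ?thesis
      proof (cases rule: converse_rtranclE)
        case base
        then show ?thesis using 1 by auto
      next
        case (step t1)
        then show ?thesis using det[OF 1] by auto
      qed
    qed
  next
    case 2
    from step.IH show ?thesis
    proof
      assume "(s, t) \<in> R\<^sup>*"
      then show ?thesis
      proof (cases rule: rtranclE)
        case base
        then show ?thesis using 2 by auto
      next
        case (step t1)
        then show ?thesis using codet[OF 2] by auto
      qed
    next
      assume "(t, s) \<in> R\<^sup>*"
      then show ?thesis using 2 by (meson converse_rtrancl_into_rtrancl)
    qed
  qed
qed simp

locale neutral_composition =
  fixes p q :: tcpart
  assumes p: "p \<in> neutral_pair_partitions" and q: "q \<in> neutral_pair_partitions"
    and composable: "upper p = lower q"
begin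

(* The strands of the stacked diagram, oriented from the normalized color White to Black.  Since
   the normalized colors of a middle point in the two diagrams are opposite, the orientations
   fit together there. *)
definition oriented :: "(stack_point \<times> stack_point) set" where
  "oriented =
     {(in_first x, in_first y) | x y. {x, y} \<in> blocks p \<and> normalized_color p x = White \<and> normalized_color p y = Black} \<union>
     {(in_second x, in_second y) | x y. {x, y} \<in> blocks q \<and> normalized_color q x = White \<and> normalized_color q y = Black}"

lemma partner_unique:
  assumes "r \<in> neutral_pair_partitions" "{x, y} \<in> blocks r" "{x, z} \<in> blocks r" 
    "normalized_color r y \<noteq> normalized_color r x" "normalized_color r z \<noteq> normalized_color r x"
  shows "y = z"
  using partitions_disjoint[OF neutral_partitions[OF assms(1)] assms(2,3), of x] assms(4,5)
  by (auto simp: doubleton_eq_iff)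

text \<open>A middle point is an upper point of p and a lower point of q, so its color is inverted
  in p only.\<close>

lemma middle_normalized_color:
  assumes "{x, y} \<in> blocks p" "{x', y'} \<in> blocks q" "in_first x = in_second x'"
  shows "normalized_color q x' = inverse_color (normalized_color p x)"
  using assms(3) composable by (cases x; cases x') auto

lemma in_first_inject: "in_first x = in_first y \<longleftrightarrow> x = y"
  and in_second_inject: "in_second x = in_second y \<longleftrightarrow> x = y"
  and in_stack_inject: "in_stack x = in_stack y \<longleftrightarrow> x = y"
  by (cases x; cases y; simp)+

lemma orientedE:
  assumes "(s, t) \<in> oriented"
  obtains (first) x y where "s = in_first x" "t = in_first y" "{x, y} \<in> blocks p"
      "normalized_color p x = White" "normalized_color p y = Black"
    | (second) x y where "s = in_second x" "t = in_second y" "{x, y} \<in> blocks q"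
      "normalized_color q x = White" "normalized_color q y = Black"
  using assms unfolding oriented_def by blast

text \<open>Two edges leaving one point belong to the same diagram, because a middle point is White
  in only one of them; then they come from the same block.\<close>

lemma single_valued_oriented: "single_valued oriented"
proof (rule single_valuedI)
  fix s t t' assume "(s, t) \<in> oriented" and st': "(s, t') \<in> oriented"
  from this(1) show "t = t'"
  proof (cases rule: orientedE)
    case f: (first x y)
    from st' show ?thesis
    proof (cases rule: orientedE)
      case (first x' y')
      then show ?thesis using f partner_unique[OF p, of x y y'] by (auto simp: in_first_inject)
    next
      case (second x' y')
      then show ?thesis using f middle_normalized_color[of x y x' y'] by auto
    qed
  next
    case s: (second x y)
    from st' show ?thesis
    proof (cases rule: orientedE)
      case (first x' y')
      then show ?thesis using s middle_normalized_color[of x' y' x y] by auto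
    next
      case (second x' y')
      then show ?thesis using s partner_unique[OF q, of x y y'] by (auto simp: in_second_inject)
    qed
  qed
qed

lemma single_valued_converse_oriented: "single_valued (oriented\<inverse>)"
proof (rule single_valuedI)
  fix s t t' assume "(s, t) \<in> oriented\<inverse>" "(s, t') \<in> oriented\<inverse>"
  hence ts: "(t, s) \<in> oriented" and ts': "(t', s) \<in> oriented" by auto
  from ts show "t = t'"
  proof (cases rule: orientedE)
    case f: (first x y)
    from ts' show ?thesis
    proof (cases rule: orientedE)
      case (first x' y')
      then show ?thesis using f partner_unique[OF p, of y x x']
        by (auto simp: in_first_inject insert_commute)
    next
      case (second x' y')
      then show ?thesis using f middle_normalized_color[of y x y' x'] by (auto simp: insert_commute)
    qed
  next
    case s: (second x y)
    from ts' show ?thesis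
    proof (cases rule: orientedE)
      case (first x' y')
      then show ?thesis using s middle_normalized_color[of y' x' y x] by (auto simp: insert_commute)
    next
      case (second x' y')
      then show ?thesis using s partner_unique[OF q, of y x x']
        by (auto simp: in_second_inject insert_commute)
    qed
  qed
qed

abbreviation outer :: tcpart where
  "outer \<equiv> Tcpart (lower p) (upper q) {}"

lemma no_predecessor:
  assumes "x \<in> points outer" "normalized_color outer x = White" shows "(s, in_stack x) \<notin> oriented"
proof
  assume "(s, in_stack x) \<in> oriented"
  thus False
  proof (cases rule: orientedE)
    case (first y z)
    then show ?thesis using assms(2) by (cases x; cases z) auto
  next
    case (second y z)
    then show ?thesis using assms(2) by (cases x; cases z) auto
  qed
qed

lemma no_successor:
  assumes "x \<in> points outer" "normalized_color outer x = Black" shows "(in_stack x, s) \<notin> oriented"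
proof
  assume "(in_stack x, s) \<in> oriented"
  thus False
  proof (cases rule: orientedE)
    case (first y z)
    then show ?thesis using assms(2) by (cases x; cases y) auto
  next
    case (second y z)
    then show ?thesis using assms(2) by (cases x; cases y) auto
  qed
qed

lemma linked_subset: "linked p q \<subseteq> (oriented \<union> oriented\<inverse>)\<^sup>*"
proof -
  have "(in_first x, in_first y) \<in> (oriented \<union> oriented\<inverse>)\<^sup>*"
    if B_in: "B \<in> blocks p" and xy: "x \<in> B" "y \<in> B" for B x y
  proof -
    obtain x' y' where B: "B = {x', y'}" "normalized_color p x' = White" "normalized_color p y' = Black"
      using neutral_blockE[OF p B_in] .
    hence "(in_first x', in_first y') \<in> oriented" using B_in by (auto simp: oriented_def)
    thus ?thesis using xy B(1) by auto
  qed
  moreover have "(in_second x, in_second y) \<in> (oriented \<union> oriented\<inverse>)\<^sup>*"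
    if B_in: "B \<in> blocks q" and xy: "x \<in> B" "y \<in> B" for B x y
  proof -
    obtain x' y' where B: "B = {x', y'}" "normalized_color q x' = White" "normalized_color q y' = Black"
      using neutral_blockE[OF q B_in] .
    hence "(in_second x', in_second y') \<in> oriented" using B_in by (auto simp: oriented_def)
    thus ?thesis using xy B(1) by auto
  qed
  ultimately show ?thesis unfolding linked_def by auto
qed

text \<open>Connected points are joined by a directed path one way or the other. Such a path cannot
  enter a White outer point nor leave a Black one, so between outer points of equal color it is
  trivial.\<close>

lemma connected_same_color:
  assumes x: "x \<in> points outer" and y: "y \<in> points outer"
    and color: "normalized_color outer x = normalized_color outer y"
    and link: "(in_stack x, in_stack y) \<in> (linked p q)\<^sup>*"
  shows "x = y"
proof -
  have "(in_stack x, in_stack y) \<in> (oriented \<union> oriented\<inverse>)\<^sup>*"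
    using link rtrancl_mono[OF linked_subset] by auto
  from connected_single_valued[OF this single_valued_oriented single_valued_converse_oriented]
  have *: "(in_stack x, in_stack y) \<in> oriented\<^sup>* \<or> (in_stack y, in_stack x) \<in> oriented\<^sup>*" .
  have "in_stack x = in_stack y"
  proof (cases "normalized_color outer x")
    case White
    with * no_predecessor[OF x] no_predecessor[OF y] color show ?thesis
      by (auto elim: rtranclE)
  next
    case Black
    with * no_successor[OF x] no_successor[OF y] color show ?thesis
      by (auto elim: converse_rtranclE)
  qed
  thus ?thesis by (simp add: in_stack_inject)
qed

text \<open>The parts of the component in p and in q both have sign sum 0. Middle points enter the
  two sums with opposite signs and cancel, leaving the outer points.\<close>

lemma sum_component:
  "(\<Sum>x\<in>{x \<in> points outer. (s, in_stack x) \<in> (linked p q)\<^sup>*}. color_sign (normalized_color outer x)) = 0"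
proof -
  define K where "K t \<longleftrightarrow> (s, t) \<in> (linked p q)\<^sup>*" for t
  have neg_if: "(if b then - c else 0) = - (if b then c else 0)" for b and c :: int by simp
  have K: "K t'" if "(t, t') \<in> linked p q" "K t" for t t'
    using that unfolding K_def by (meson rtrancl.rtrancl_into_rtrancl)
  have "(\<Sum>x\<in>{x \<in> points p. K (in_first x)}. color_sign (normalized_color p x)) = 0"
    by (rule sum_color_sign_saturated[OF p]) (rule K, auto simp: linked_def)
  moreover have "(\<Sum>x\<in>{x \<in> points q. K (in_second x)}. color_sign (normalized_color q x)) = 0"
    by (rule sum_color_sign_saturated[OF q]) (rule K, auto simp: linked_def)
  ultimately have "(\<Sum>x\<in>{x \<in> points outer. K (in_stack x)}. color_sign (normalized_color outer x)) = 0"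
    using composable by (simp add: sum.inter_filter sum_points sum_negf neg_if cong: if_cong)
  thus ?thesis by (simp add: K_def)
qed

text \<open>Blocks are determined by counting instead of following strands: a block is nonempty, has
  at most one point of each normalized color, and has sign sum 0, so it has exactly one of
  each.\<close>

lemma composition_neutral: "composition p q \<in> neutral_pair_partitions"
proof (rule neutral_pair_partitionsI)
  let ?A = "points outer"
  let ?r = "{(x, y) \<in> ?A \<times> ?A. (in_stack x, in_stack y) \<in> (linked p q)\<^sup>*}"
  have comp: "composition p q = Tcpart (lower p) (upper q) (?A // ?r)"
    by (simp add: composition_def Let_def)
  have points: "points (composition p q) = ?A"
    and color: "normalized_color (composition p q) x = normalized_color outer x" for x
    by (simp_all add: comp points_def) (cases x; simp)
  have "sym (linked p q)" by (auto simp: sym_def linked_def)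
  hence sym: "sym ((linked p q)\<^sup>*)" by (rule sym_rtrancl)
  have "equiv ?A ?r"
    by (rule equivI) (auto simp: refl_on_def intro!: symI transI dest: symD[OF sym] rtrancl_trans)
  thus "composition p q \<in> partitions"
    using partition_on_quotient points by (simp add: partitions_def comp)
  fix B assume "B \<in> blocks (composition p q)"
  then obtain a where a: "a \<in> ?A" "B = ?r `` {a}"
    by (auto simp: comp quotient_def)
  hence B: "B = {x \<in> ?A. (in_stack a, in_stack x) \<in> (linked p q)\<^sup>*}" by auto
  have aB: "a \<in> B" using a by auto
  have same: "x = y" if "x \<in> B" "y \<in> B" "normalized_color outer x = normalized_color outer y" for x y
  proof (rule connected_same_color)
    show "(in_stack x, in_stack y) \<in> (linked p q)\<^sup>*"
      using that B symD[OF sym] by (auto intro: rtrancl_trans)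
  qed (use that B in auto)
  have sum: "(\<Sum>x\<in>B. color_sign (normalized_color outer x)) = 0"
    unfolding B by (rule sum_component)
  have fin: "finite B" using B by simp
  obtain b where b: "b \<in> B" "normalized_color outer b \<noteq> normalized_color outer a"
  proof (rule ccontr)
    assume "\<not> thesis"
    hence "B = {a}" using same aB that by blast
    thus False using sum by (cases "normalized_color outer a") auto
  qed
  have "x = a \<or> x = b" if "x \<in> B" for x
    using same[OF that aB] same[OF that b(1)] b(2) neq_color_iff by metis
  hence Bab: "B = {a, b}" using aB b by auto
  show "\<exists>x y. B = {x, y} \<and> normalized_color (composition p q) x = White \<and>
      normalized_color (composition p q) y = Black"
    using b(2) Bab unfolding color
    by (cases "normalized_color outer a"; cases "normalized_color outer b") (auto simp: insert_commute)
qed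

end

section \<open>Tensor product, involution and generators\<close>

lemma partition_on_inj_image_nonempty:
  assumes "partition_on A P" "inj f" shows "partition_on (f ` A) ((`) f ` P)"
proof -
  have "{} \<notin> (`) f ` P" using partition_onD3[OF assms(1)] by auto
  thus ?thesis using partition_on_inj_image[OF assms(1) inj_on_subset[OF assms(2) subset_UNIV]] by simp
qed

lemma tensor_neutral:
  assumes p: "p \<in> neutral_pair_partitions" and q: "q \<in> neutral_pair_partitions"
  shows "tensor p q \<in> neutral_pair_partitions"
proof (rule neutral_pair_partitionsI)
  let ?s = "shift_point (length (lower p)) (length (upper p))"
  have inj: "inj ?s"
  proof (rule injI)
    fix x y assume "?s x = ?s y" thus "x = y" by (cases x; cases y) auto
  qed
  have "x \<in> points (tensor p q) \<longleftrightarrow> x \<in> points p \<union> ?s ` points q" for x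
  proof (cases x)
    case (Low i)
    have "Low i \<in> ?s ` points q \<longleftrightarrow> length (lower p) \<le> i \<and> i < length (lower p) + length (lower q)"
    proof
      assume "Low i \<in> ?s ` points q"
      then obtain x where "x \<in> points q" "Low i = ?s x" by blast
      then show "length (lower p) \<le> i \<and> i < length (lower p) + length (lower q)" by (cases x) auto
    next
      assume "length (lower p) \<le> i \<and> i < length (lower p) + length (lower q)"
      then show "Low i \<in> ?s ` points q" by (intro image_eqI[of _ _ "Low (i - length (lower p))"]) auto
    qed
    then show ?thesis by (auto simp: Low tensor_def)
  next
    case (Up i)
    have "Up i \<in> ?s ` points q \<longleftrightarrow> length (upper p) \<le> i \<and> i < length (upper p) + length (upper q)"
    proof
      assume "Up i \<in> ?s ` points q"
      then obtain x where "x \<in> points q" "Up i = ?s x" by blast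
      then show "length (upper p) \<le> i \<and> i < length (upper p) + length (upper q)" by (cases x) auto
    next
      assume "length (upper p) \<le> i \<and> i < length (upper p) + length (upper q)"
      then show "Up i \<in> ?s ` points q" by (intro image_eqI[of _ _ "Up (i - length (upper p))"]) auto
    qed
    then show ?thesis by (auto simp: Up tensor_def)
  qed
  hence points: "points (tensor p q) = points p \<union> ?s ` points q" by blast
  have disj: "points p \<inter> ?s ` points q = {}"
    by (auto simp: points_def)
  have P: "partition_on (points p) (blocks p)" and Q: "partition_on (points q) (blocks q)"
    using p q neutral_partitions by (auto simp: partitions_def)
  have Q': "partition_on (?s ` points q) ((`) ?s ` blocks q)"
    using Q inj by (rule partition_on_inj_image_nonempty)
  have "partition_on (points (tensor p q)) (blocks p \<union> (`) ?s ` blocks q)"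
    unfolding points
  proof (rule partition_onI)
    show "\<Union> (blocks p \<union> (`) ?s ` blocks q) = points p \<union> ?s ` points q"
      unfolding Union_Un_distrib partition_onD1[OF P, symmetric] partition_onD1[OF Q', symmetric] ..
    show "{} \<notin> blocks p \<union> (`) ?s ` blocks q"
      using partition_onD3[OF P] partition_onD3[OF Q'] by blast
    fix B B' assume B: "B \<in> blocks p \<union> (`) ?s ` blocks q" "B' \<in> blocks p \<union> (`) ?s ` blocks q"
      and neq: "B \<noteq> B'"
    have sub: "B \<subseteq> points p" if "B \<in> blocks p" for B
      using that partition_onD1[OF P] by blast
    have sub': "B \<subseteq> ?s ` points q" if "B \<in> (`) ?s ` blocks q" for B
      using that partition_onD1[OF Q'] by blast
    from B show "disjnt B B'"
    proof (elim UnE)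
      assume "B \<in> blocks p" "B' \<in> blocks p"
      thus ?thesis using partition_onD2[OF P] neq by (simp add: disjointD disjnt_def)
    next
      assume "B \<in> (`) ?s ` blocks q" "B' \<in> (`) ?s ` blocks q"
      thus ?thesis using partition_onD2[OF Q'] neq by (simp add: disjointD disjnt_def)
    next
      assume "B \<in> blocks p" "B' \<in> (`) ?s ` blocks q"
      from sub[OF this(1)] sub'[OF this(2)] show ?thesis using disj unfolding disjnt_def by blast
    next
      assume "B \<in> (`) ?s ` blocks q" "B' \<in> blocks p"
      from sub'[OF this(1)] sub[OF this(2)] show ?thesis using disj unfolding disjnt_def by blast
    qed
  qed
  thus "tensor p q \<in> partitions" by (simp add: partitions_def tensor_def)
  fix B assume "B \<in> blocks (tensor p q)"
  then consider "B \<in> blocks p" | B' where "B' \<in> blocks q" "B = ?s ` B'"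
    by (auto simp: tensor_def)
  thus "\<exists>x y. B = {x, y} \<and> normalized_color (tensor p q) x = White \<and> normalized_color (tensor p q) y = Black"
  proof cases
    case 1
    have "normalized_color (tensor p q) x = normalized_color p x" if "x \<in> points p" for x
      using that by (cases x) (auto simp: tensor_def nth_append)
    moreover obtain x y where "B = {x, y}" "normalized_color p x = White" "normalized_color p y = Black"
      using neutral_blockE[OF p 1] .
    ultimately show ?thesis using partitions_block_subset[OF neutral_partitions[OF p] 1]
      by (intro exI[of _ x] exI[of _ y]) simp
  next
    case 2
    have "normalized_color (tensor p q) (?s x) = normalized_color q x" for x
      by (cases x) (auto simp: tensor_def nth_append)
    moreover obtain x y where "B' = {x, y}" "normalized_color q x = White" "normalized_color q y = Black"
      using neutral_blockE[OF q 2(1)] .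
    ultimately show ?thesis using 2(2) by (intro exI[of _ "?s x"] exI[of _ "?s y"]) simp
  qed
qed

lemma involution_neutral:
  assumes p: "p \<in> neutral_pair_partitions"
  shows "involution p \<in> neutral_pair_partitions"
proof (rule neutral_pair_partitionsI)
  have inj: "inj swap_point"
  proof (rule injI)
    fix x y assume "swap_point x = swap_point y" thus "x = y" by (cases x; cases y) auto
  qed
  have P: "partition_on (points p) (blocks p)"
    using p neutral_partitions by (auto simp: partitions_def)
  have "points (involution p) = swap_point ` points p"
    by (auto simp: points_def involution_def image_Un image_image)
  moreover have "partition_on (swap_point ` points p) ((`) swap_point ` blocks p)"
    using P inj by (rule partition_on_inj_image_nonempty)
  ultimately show "involution p \<in> partitions" by (simp add: partitions_def involution_def)
  fix B assume "B \<in> blocks (involution p)"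
  then obtain B' where B': "B' \<in> blocks p" "B = swap_point ` B'"
    by (auto simp: involution_def)
  have color: "normalized_color (involution p) (swap_point x) = inverse_color (normalized_color p x)" for x
    by (cases x) (auto simp: involution_def)
  obtain x y where "B' = {x, y}" "normalized_color p x = White" "normalized_color p y = Black"
    using neutral_blockE[OF p B'(1)] .
  \<comment> \<open>Swapping the rows inverts all normalized colors, so the two ends of the block
    exchange roles.\<close>
  thus "\<exists>x y. B = {x, y} \<and> normalized_color (involution p) x = White \<and> normalized_color (involution p) y = Black"
    using B'(2) color by (intro exI[of _ "swap_point y"] exI[of _ "swap_point x"]) auto
qed

lemma single_block_neutral:
  assumes "points p = {x, y}" "blocks p = {{x, y}}" "normalized_color p x = White" "normalized_color p y = Black"
  shows "p \<in> neutral_pair_partitions"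
  using assms by (intro neutral_pair_partitionsI) (auto simp: partitions_def partition_on_space)

lemma category_neutral_pair_partitions: "category neutral_pair_partitions"
proof -
  have "identity_part c \<in> neutral_pair_partitions" for c
  proof (cases c)
    case White
    then show ?thesis
      by (intro single_block_neutral[of _ "Low 0" "Up 0"]) (auto simp: identity_part_def points_def)
  next
    case Black
    then show ?thesis
      by (intro single_block_neutral[of _ "Up 0" "Low 0"]) (auto simp: identity_part_def points_def)
  qed
  moreover have "pair_part White Black \<in> neutral_pair_partitions"
    by (rule single_block_neutral[of _ "Low 0" "Low 1"]) (auto simp: pair_part_def points_def)
  moreover have "pair_part Black White \<in> neutral_pair_partitions"
    by (rule single_block_neutral[of _ "Low 1" "Low 0"]) (auto simp: pair_part_def points_def)
  moreover have "composition p q \<in> neutral_pair_partitions"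
    if "p \<in> neutral_pair_partitions" "q \<in> neutral_pair_partitions" "composable p q" for p q
    using that by (intro neutral_composition.composition_neutral)
      (simp add: neutral_composition_def composable_def)
  ultimately show ?thesis
    unfolding category_def by (intro conjI ballI impI subsetI neutral_partitions tensor_neutral involution_neutral)
qed

lemma crossing_neutral: "crossing \<in> neutral_pair_partitions"
proof (rule neutral_pair_partitionsI)
  show "crossing \<in> partitions"
    by (auto simp: crossing_def partitions_def partition_on_def points_def disjoint_def numeral_2_eq_2 lessThan_Suc)
next
  fix B assume "B \<in> blocks crossing"
  hence "B = {Low 0, Up 1} \<or> B = {Low 1, Up 0}" by (auto simp: crossing_def)
  thus "\<exists>x y. B = {x, y} \<and> normalized_color crossing x = White \<and> normalized_color crossing y = Black"
  proof
    assume "B = {Low 0, Up 1}"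
    thus ?thesis by (intro exI[of _ "Low 0"] exI[of _ "Up 1"]) (simp add: crossing_def)
  next
    assume "B = {Low 1, Up 0}"
    thus ?thesis by (intro exI[of _ "Low 1"] exI[of _ "Up 0"]) (simp add: crossing_def)
  qed
qed

text \<open>This is how the upper bound on C enters: all its members are neutral pair
  partitions.\<close>

lemma generated_category_crossing_subset: "generated_category {crossing} \<subseteq> neutral_pair_partitions"
  unfolding generated_category_def
  using category_neutral_pair_partitions crossing_neutral by (intro hull_minimal) auto

subsection \<open>Sectors as commutation relations\<close>

context word_congruence
begin

text \<open>These k form the preimage of the centralizer of x under the map sending k to z^k, hence
  a subgroup of the integers.\<close>

definition fixed_exponent :: "'a \<Rightarrow> 'a \<Rightarrow> int \<Rightarrow> bool" where
  "fixed_exponent x z k \<longleftrightarrow> conjugate (White, x) (letter_power z k) \<approx> letter_power z k"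

lemma conjugate_inverse:
  assumes "conjugate a u \<approx> v" shows "conjugate (inv_letter a) v \<approx> u"
proof -
  have "conjugate (inv_letter a) v \<approx> conjugate (inv_letter a) (conjugate a u)"
    by (rule cong_conjugate[OF cong_sym[OF assms]])
  also have "\<dots> = [inv_letter a, a] @ u @ [inv_letter a, a]"
    by (simp add: conjugate_def)
  also have "\<dots> \<approx> [] @ u @ []"
    by (rule cong_append[OF cong_cancel_letter' cong_append[OF cong_refl cong_cancel_letter']])
  finally show ?thesis by simp
qed

lemma fixed_exponent_iff:
  "fixed_exponent x z k \<longleftrightarrow> conjugate (c, x) (letter_power z k) \<approx> letter_power z k"
  using conjugate_inverse[of "(White, x)" "letter_power z k" "letter_power z k"]
    conjugate_inverse[of "(Black, x)" "letter_power z k" "letter_power z k"]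
  unfolding fixed_exponent_def by (cases c) auto

lemma fixed_exponent_0: "fixed_exponent x z 0"
  using cong_cancel_letter[of "(White, x)"]
  by (simp add: fixed_exponent_def letter_power_def conjugate_def)

lemma fixed_exponent_add:
  assumes "fixed_exponent x z k" "fixed_exponent x z l" shows "fixed_exponent x z (k + l)"
proof -
  let ?a = "(White, x)"
  have sum: "letter_power z k @ letter_power z l \<approx> letter_power z (k + l)"
    by (rule cong_letter_power_add) simp
  have "conjugate ?a (letter_power z (k + l)) \<approx> conjugate ?a (letter_power z k @ letter_power z l)"
    by (rule cong_conjugate[OF cong_sym[OF sum]])
  also have "\<dots> \<approx> conjugate ?a (letter_power z k) @ conjugate ?a (letter_power z l)"
    by (rule cong_sym[OF conjugate_append])
  also have "\<dots> \<approx> letter_power z k @ letter_power z l"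
    using assms unfolding fixed_exponent_def by (rule cong_append)
  also note sum
  finally show ?thesis unfolding fixed_exponent_def .
qed

lemma fixed_exponent_uminus:
  assumes "fixed_exponent x z k" shows "fixed_exponent x z (- k)"
  using cong_inv_word[OF assms[unfolded fixed_exponent_def]]
  by (simp add: fixed_exponent_def conjugate_def)

end

lemma int_subgroup_generator:
  fixes P :: "int \<Rightarrow> bool"
  assumes "P 0" and add: "\<And>k l. P k \<Longrightarrow> P l \<Longrightarrow> P (k + l)" and uminus: "\<And>k. P k \<Longrightarrow> P (- k)"
  shows "\<exists>g::nat. \<forall>k. P k \<longleftrightarrow> int g dvd k"
proof (cases "\<exists>n::nat. n > 0 \<and> P (int n)")
  case False
  have "k = 0" if "P k" for k
  proof (rule ccontr)
    assume "k \<noteq> 0"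
    moreover have "P \<bar>k\<bar>" using uminus[OF that] that by (simp add: abs_if)
    ultimately show False using False by (metis nat_0_iff int_nat_eq abs_ge_zero abs_eq_0 gr0I)
  qed
  then show ?thesis using assms(1) by (intro exI[of _ 0]) auto
next
  case True
  define g where "g = (LEAST n. n > 0 \<and> P (int n))"
  have g: "g > 0" "P (int g)" using LeastI_ex[OF True] by (auto simp: g_def)
  have least: "g \<le> n" if "n > 0" "P (int n)" for n
    unfolding g_def using that by (intro Least_le) simp
  have pos: "P (int n * int g)" for n
    by (induction n) (auto simp: assms(1) distrib_right intro: add g)
  have mult: "P (m * int g)" for m
    using pos uminus[OF pos] by (cases m rule: int_cases2) auto
  have "int g dvd k" if "P k" for k
  proof -
    have "P (k + (- (k div int g)) * int g)" by (rule add[OF that mult])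
    also have "k + (- (k div int g)) * int g = k mod int g"
      by (simp add: minus_div_mult_eq_mod[symmetric])
    finally have "P (int (nat (k mod int g)))" using g(1) by simp
    hence "\<not> 0 < nat (k mod int g)" using least[of "nat (k mod int g)"] g(1)
      by (metis nat_less_iff not_less of_nat_0_less_iff pos_mod_bound pos_mod_sign)
    thus ?thesis using g(1) by (auto simp: dvd_eq_mod_eq_0 intro: antisym)
  qed
  moreover have "P k" if "int g dvd k" for k
    using that mult by (metis dvdE mult.commute)
  ultimately show ?thesis by blast
qed

lemma list_split_two:
  assumes "i < j" "j < length xs"
  shows "take (Suc (j - i)) (drop i xs) = xs ! i # take (j - i - 1) (drop (Suc i) xs) @ [xs ! j]"
    and "xs = take i xs @ take (Suc (j - i)) (drop i xs) @ drop (Suc j) xs"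
proof -
  obtain k where j: "j = Suc (i + k)" using assms(1) less_iff_Suc_add by auto
  show "take (Suc (j - i)) (drop i xs) = xs ! i # take (j - i - 1) (drop (Suc i) xs) @ [xs ! j]"
  proof -
    have "drop i xs = xs ! i # drop (Suc i) xs" using assms by (simp add: Cons_nth_drop_Suc)
    moreover have "take (Suc k) (drop (Suc i) xs) = take k (drop (Suc i) xs) @ [xs ! j]"
      using assms by (simp add: j take_Suc_conv_app_nth)
    ultimately show ?thesis by (simp add: j)
  qed
  have "xs = take i xs @ drop i xs" by simp
  also have "drop i xs = take (Suc (j - i)) (drop i xs) @ drop (Suc (j - i)) (drop i xs)"
    by (rule append_take_drop_id[symmetric])
  also have "drop (Suc (j - i)) (drop i xs) = drop (Suc j) xs" using assms by simp
  finally show "xs = take i xs @ take (Suc (j - i)) (drop i xs) @ drop (Suc j) xs" .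
qed

lemma distinct_cyclic_order [simp]: "distinct (cyclic_order p)"
  and set_cyclic_order [simp]: "set (cyclic_order p) = points p"
  by (auto simp: cyclic_order_def points_def distinct_map inj_on_def)

lemma height_map_points:
  "distinct xs \<Longrightarrow> height (map (\<lambda>x. (normalized_color p x, f x)) xs) = - color_sum p (set xs)"
  by (simp add: height_def comp_def color_sum_eq sum_list_distinct_conv_sum_set)

lemma color_sum_points: "p \<in> neutral_pair_partitions \<Longrightarrow> color_sum p (points p) = 0"
  using sum_color_sign_saturated[of p "\<lambda>_. True"] by (simp add: color_sum_eq)

lemma neutral_block_opposite:
  assumes "p \<in> neutral_pair_partitions" "{x, y} \<in> blocks p"
  shows "normalized_color p y = inverse_color (normalized_color p x)"
  using neutral_blockE[OF assms] by (metis doubleton_eq_iff inverse_color.simps)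

section \<open>Relations obtained from a category of neutral pair partitions\<close>

locale neutral_category =
  fixes C :: "tcpart set"
  assumes category: "category C" and neutral: "C \<subseteq> neutral_pair_partitions"
begin

text \<open>With natural numbers as letters there are always enough of them to number the blocks of
  a partition injectively.\<close>

sublocale word_congruence "row_relation C :: (color \<times> nat) list \<Rightarrow> _"
  by (rule word_congruence_row_relation[OF category])

text \<open>Read from the start of the sector, the word is a u a^-1 v with u and v words in the
  letter 0. The total height is 0, so v represents the inverse of the power represented by u, and a
  commutes with that power.\<close>

lemma sector_fixed_exponent:
  assumes p: "p \<in> C" and S: "sector p S"
  shows "fixed_exponent 1 0 (color_sum p S)"
proof -
  let ?n = "length (cyclic_order p)"
  have pn: "p \<in> neutral_pair_partitions" using p neutral by auto
  obtain i k where i: "i < ?n" and k: "k < ?n" and S_eq: "S = cyclic_point p i ` {0..k}"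
    and B: "{cyclic_point p i 0, cyclic_point p i k} \<in> blocks p"
    using S unfolding sector_def by blast
  define L where "L = rotate i (cyclic_order p)"
  have L: "distinct L" "set L = points p" "length L = ?n" by (simp_all add: L_def)
  have nth: "cyclic_point p i m = L ! m" if "m < ?n" for m
    using that by (simp add: L_def cyclic_point_def nth_rotate)
  have nth0: "cyclic_point p i 0 = L ! 0" using i by (intro nth) linarith
  have opp: "normalized_color p (L ! k) = inverse_color (normalized_color p (L ! 0))"
    using neutral_block_opposite[OF pn B] nth0 nth[OF k] by simp
  \<comment> \<open>The ends of a block have opposite normalized colors, so they are distinct
    points.\<close>
  have "k \<noteq> 0"
  proof
    assume "k = 0"
    with opp have "normalized_color p (L ! 0) = inverse_color (normalized_color p (L ! 0))" by simp
    thus False by (simp only: inverse_color_neq)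
  qed
  have S_set: "S = set (take (Suc k) L)"
  proof -
    have "S = (!) L ` {0..<Suc k}"
      unfolding S_eq using nth k by (intro image_cong) auto
    thus ?thesis using nth_image[of "Suc k" L] k L(3) by simp
  qed
  define f :: "point \<Rightarrow> nat" where "f x = (if x = L ! 0 \<or> x = L ! k then 1 else 0)" for x
  have B': "{L ! 0, L ! k} \<in> blocks p" using B nth0 nth[OF k] by simp
  have "block_labelling p f"
  proof (rule block_labellingI)
    fix B x y assume Bxy: "B \<in> blocks p" "x \<in> B" "y \<in> B"
    have "v \<in> {L ! 0, L ! k}" if "u \<in> B" "v \<in> B" "u \<in> {L ! 0, L ! k}" for u v
      using partitions_disjoint[OF neutral_partitions[OF pn] Bxy(1) B' that(1,3)] that(2) by simp
    from this[OF Bxy(2,3)] this[OF Bxy(3,2)] show "f x = f y" by (auto simp: f_def)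
  qed
  hence "row_relation C (cyclic_word p f) []"
    using cyclic_word_cong_Nil_iff[OF category] p by blast
  hence rot: "row_relation C (rotate i (cyclic_word p f)) []"
    using cong_rotate[of "take i (cyclic_word p f)" "drop i (cyclic_word p f)"] i
    by (simp add: rotate_drop_take cyclic_word_def)
  define F where "F x = (normalized_color p x, f x)" for x
  define mid where "mid = map F (take (k - 1) (drop 1 L))"
  define rest where "rest = map F (drop (Suc k) L)"
  define a where "a = F (L ! 0)"
  have a: "a = (fst a, 1)" by (simp add: a_def F_def f_def)
  have Lk: "F (L ! k) = inv_letter a" by (simp add: a_def F_def f_def opp)
  have split: "take (Suc k) L = L ! 0 # take (k - 1) (drop 1 L) @ [L ! k]"
    "L = take (Suc k) L @ drop (Suc k) L"
    using list_split_two[of 0 k L] k L(3) \<open>k \<noteq> 0\<close> by simp_all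
  have conj: "map F (take (Suc k) L) = conjugate a mid"
    unfolding split(1) by (simp add: mid_def conjugate_def Lk a_def)
  have F: "F = (\<lambda>x. (normalized_color p x, f x))" by (simp add: F_def fun_eq_iff)
  have rotF: "rotate i (cyclic_word p f) = map F L"
    by (simp add: L_def rotate_map cyclic_word_def F)
  have t: "map F L = conjugate a mid @ rest"
    using arg_cong[OF split(2), of "map F"] unfolding map_append conj rest_def .
  have cong: "row_relation C (conjugate a mid @ rest) []"
    using rot unfolding rotF t .
  have "distinct (L ! 0 # take (k - 1) (drop 1 L) @ [L ! k] @ drop (Suc k) L)"
    using L(1) split(2) unfolding split(1) by simp
  hence labels: "snd ` set mid \<subseteq> {0}" "snd ` set rest \<subseteq> {0}"
    by (auto simp: mid_def rest_def F_def f_def)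
  have "height (map F L) = 0"
    unfolding F_def using height_map_points[OF L(1), of p f] color_sum_points[OF pn] L(2) by simp
  hence heights: "height rest = - height mid"
    by (simp add: t conjugate_def)
  \<comment> \<open>The letters at the two ends cancel in the height, so the sector and its interior
    have equal heights.\<close>
  have "height (map F (take (Suc k) L)) = - color_sum p S"
    unfolding F_def S_set using L(1) by (intro height_map_points) simp
  hence mid: "height mid = - color_sum p S" by (simp add: conj conjugate_def)
  have "row_relation C (conjugate a (letter_power 0 (height mid))) (conjugate a mid)"
    by (rule cong_conjugate[OF cong_sym[OF cong_letter_power_height[OF labels(1)]]])
  also have "row_relation C (conjugate a mid) (inv_word rest)"
    using cong_move_right[OF cong] by simp
  also have "row_relation C (inv_word rest) (letter_power 0 (height mid))"
    using cong_inv_word[OF cong_letter_power_height[OF labels(2)]] by (simp add: heights)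
  finally have "row_relation C (conjugate a (letter_power 0 (height mid))) (letter_power 0 (height mid))" .
  hence "fixed_exponent 1 0 (- color_sum p S)"
    using fixed_exponent_iff[of 1 0 _ "fst a"] a mid by simp
  thus ?thesis using fixed_exponent_uminus by fastforce
qed

text \<open>The relation for the letters 1 and 0 comes from a partition in C whose blocks are the
  pair of ends of the lower row and pairs joining the two rows. Relabelled, it transports Y to a
  permuted word on the upper row. This word serves every x, so all conjugates of Y by letters of one
  color agree.\<close>

lemma uniform_of_fixed_exponent:
  assumes fixed: "fixed_exponent 1 0 (int (length Y))" and white: "fst ` set Y \<subseteq> {White}"
  shows "uniform Y"
proof -
  let ?g = "length Y"
  have "\<exists>Y'. \<forall>x. row_relation C (conjugate (c, x) Y) Y'" for c
  proof -
    have "row_relation C (conjugate (c, 1 :: nat) (letter_power 0 (int ?g))) (letter_power 0 (int ?g))"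
      using fixed fixed_exponent_iff by blast
    then obtain p where p: "p \<in> C" and lower: "lower p = c # replicate ?g White @ [inverse_color c]"
      and upper: "upper p = replicate ?g White"
      and lab: "block_labelling p (word_label (conjugate (c, 1 :: nat) (letter_power 0 (int ?g))) (letter_power 0 (int ?g)))"
      by (rule row_relationE) (auto simp: conjugate_def letter_power_def)
    let ?lab = "word_label (conjugate (c, 1 :: nat) (letter_power 0 (int ?g))) (letter_power 0 (int ?g))"
    have pn: "p \<in> neutral_pair_partitions" using p neutral by auto
    have part: "p \<in> partitions" by (rule neutral_partitions[OF pn])
    define partner where "partner j = (SOME i. {Low i, Up j} \<in> blocks p)" for j
    \<comment> \<open>The lower row reads as the conjugate of Y, so position i carries entry i - 1
      of Y; an upper point copies the letter of the lower point it is joined to.\<close>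
    define f where "f x y = (case y of
        Low i \<Rightarrow> if i = 0 \<or> i = Suc ?g then x else snd (Y ! (i - 1))
      | Up j \<Rightarrow> snd (Y ! (partner j - 1)))" for x y
    have f_label: "block_labelling p (f x)" for x
    proof (rule block_labellingI)
      fix B y z assume B: "B \<in> blocks p" and yz: "y \<in> B" "z \<in> B"
      obtain a b where ab: "B = {a, b}" "normalized_color p a = White" "normalized_color p b = Black"
        using neutral_blockE[OF pn B] .
      have pts: "a \<in> points p" "b \<in> points p" using ab(1) partitions_block_subset[OF part B] by auto
      have eq: "?lab a = ?lab b" using block_labellingD[OF lab B, of a b] ab(1) by blast
      \<comment> \<open>Label 1 marks exactly the two ends of the lower row, so no block joins an
        end to any other point.\<close>
      have lab1: "?lab y = 1 \<longleftrightarrow> y = Low 0 \<or> y = Low (Suc ?g)" if "y \<in> points p" for y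
        using that by (cases y) (auto simp: lower upper conjugate_def letter_power_def nth_Cons' nth_append)
      have "f x a = f x b"
      proof (cases "?lab a = 1")
        case True
        have "a = Low 0 \<or> a = Low (Suc ?g)" using True lab1[OF pts(1)] by blast
        moreover have "b = Low 0 \<or> b = Low (Suc ?g)" using True lab1[OF pts(2)] unfolding eq by blast
        ultimately show ?thesis by (auto simp: f_def)
      next
        case False
        have na: "a \<noteq> Low 0" "a \<noteq> Low (Suc ?g)" using False lab1[OF pts(1)] by blast+
        have nb: "b \<noteq> Low 0" "b \<noteq> Low (Suc ?g)" using False lab1[OF pts(2)] unfolding eq by blast+
        \<comment> \<open>Apart from the two ends, all lower points have normalized color White and
          all upper points Black, so the block joins the rows.\<close>
        obtain i where a: "a = Low i" using ab(2) pts(1) by (cases a) (auto simp: upper)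
        obtain j where b: "b = Up j" using ab(3) pts(2) nb
          by (cases b) (auto simp: lower nth_Cons' nth_append split: if_splits)
        have ij: "{Low i, Up j} \<in> blocks p" using B ab(1) a b by simp
        hence "{Low (partner j), Up j} \<in> blocks p" unfolding partner_def by (rule someI)
        from partitions_disjoint[OF part this ij, of "Up j"] have "partner j = i"
          by (auto simp: doubleton_eq_iff)
        then show ?thesis using na by (simp add: f_def a b)
      qed
      thus "f x y = f x z" using yz ab(1) by auto
    qed
    have lower_f: "lower_word p (f x) = conjugate (c, x) Y" for x
    proof (rule nth_equalityI)
      show "length (lower_word p (f x)) = length (conjugate (c, x) Y)"
        by (simp add: lower_word_def lower conjugate_def)
      fix i assume "i < length (lower_word p (f x))"
      hence i: "i < Suc (Suc ?g)" by (simp add: lower_word_def lower)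
      consider "i = 0" | "i = Suc ?g" | m where "i = Suc m" "m < ?g"
        using i by (cases i) (auto simp: less_Suc_eq)
      thus "lower_word p (f x) ! i = conjugate (c, x) Y ! i"
      proof cases
        case 3
        have "Y ! m \<in> set Y" using 3 by simp
        hence "fst (Y ! m) = White" using white by blast
        then show ?thesis using 3 by (simp add: lower_word_def lower conjugate_def f_def nth_append prod_eq_iff del: upt_Suc)
      qed (simp_all add: lower_word_def lower conjugate_def f_def nth_append del: upt_Suc)
    qed
    have rel: "row_relation C (lower_word p (f x)) (upper_word p (f x))" for x
      using row_relation_row_words_iff[of C p "f x"] category p f_label[of x]
      by (auto simp: category_def)
    \<comment> \<open>The letter x occurs only at the ends of the lower row.\<close>
    have upper_f: "upper_word p (f x) = upper_word p (f 0)" for x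
      by (simp add: upper_word_def f_def)
    have "row_relation C (conjugate (c, x) Y) (upper_word p (f 0))" for x
      using rel[of x] unfolding lower_f upper_f[of x] .
    thus ?thesis by blast
  qed
  then obtain Y' where Y': "row_relation C (conjugate (c, x) Y) (Y' c)" for c x by metis
  show ?thesis
  proof (rule uniformI)
    fix a b :: "color \<times> nat" assume "fst a = fst b"
    thus "row_relation C (conjugate a Y) (conjugate b Y)"
      using cong_trans[OF Y' cong_sym[OF Y']] by (cases a; cases b) simp
  qed
qed

section \<open>Numbering blocks and recovering a partition from its word\<close>

lemma exists_block_numbering:
  assumes p: "p \<in> partitions"
  shows "\<exists>f :: point \<Rightarrow> nat. \<forall>B \<in> blocks p. \<forall>x \<in> B. \<forall>y \<in> points p. f y = f x \<longleftrightarrow> y \<in> B"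
proof -
  have part: "partition_on (points p) (blocks p)" using p by (simp add: partitions_def)
  have "finite (blocks p)" by (rule finite_elements[OF finite_points part])
  then obtain e :: "point set \<Rightarrow> nat" where e: "inj_on e (blocks p)"
    using finite_imp_inj_to_nat_seg by blast
  define f where "f x = e (THE B. B \<in> blocks p \<and> x \<in> B)" for x
  have f: "f x = e B" if "B \<in> blocks p" "x \<in> B" for x B
  proof -
    have "(THE B. B \<in> blocks p \<and> x \<in> B) = B"
    proof (rule the_equality)
      show "B \<in> blocks p \<and> x \<in> B" using that by simp
      show "B' = B" if "B' \<in> blocks p \<and> x \<in> B'" for B'
        using partitions_disjoint[OF p, of B' B x] that \<open>B \<in> blocks p\<close> \<open>x \<in> B\<close> by simp
    qed
    thus ?thesis by (simp add: f_def)
  qed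
  have "f y = f x \<longleftrightarrow> y \<in> B" if B: "B \<in> blocks p" and x: "x \<in> B" and y: "y \<in> points p" for B x y
  proof -
    obtain B' where B': "B' \<in> blocks p" "y \<in> B'" using partitions_obtain_block[OF p y] .
    have "f y = f x \<longleftrightarrow> B' = B"
      using f[OF B x] f[OF B'] inj_on_eq_iff[OF e B'(1) B] by simp
    also have "\<dots> \<longleftrightarrow> y \<in> B" using partitions_disjoint[OF p B'(1) B B'(2)] B'(2) by auto
    finally show ?thesis .
  qed
  thus ?thesis by blast
qed

text \<open>In an injective labelling each letter occurs once with each sign and the two occurrences
  enclose a sector, so the word can be erased. The resulting partition in C respects the labelling,
  which identifies it with p.\<close>

lemma sector_category_subset:
  assumes g: "g > 0" and fixed: "fixed_exponent 1 0 (int g)"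
  shows "sector_category g \<subseteq> C"
proof
  fix p assume "p \<in> sector_category g"
  hence pn: "p \<in> neutral_pair_partitions" and sectors: "\<And>S. sector p S \<Longrightarrow> int g dvd color_sum p S"
    by (auto simp: sector_category_def)
  have part: "p \<in> partitions" by (rule neutral_partitions[OF pn])
  obtain f :: "point \<Rightarrow> nat" where
    f: "\<And>B x y. B \<in> blocks p \<Longrightarrow> x \<in> B \<Longrightarrow> y \<in> points p \<Longrightarrow> f y = f x \<longleftrightarrow> y \<in> B"
    using exists_block_numbering[OF part] by blast
  define L where "L = cyclic_order p"
  define F where "F x = (normalized_color p x, f x)" for x
  define t where "t = map F L"
  have L: "distinct L" "set L = points p" by (simp_all add: L_def)
  have interval: "\<exists>\<alpha> \<beta> \<gamma> c. t = \<alpha> @ conjugate (c, f (L ! i)) \<beta> @ \<gamma> \<and>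
      f (L ! i) \<notin> snd ` set (\<alpha> @ \<beta> @ \<gamma>) \<and> int g dvd height \<beta>"
    if ij: "i < j" "j < length L" and B: "{L ! i, L ! j} \<in> blocks p" for i j
  proof -
    let ?M = "take (Suc (j - i)) (drop i L)"
    let ?N = "take (j - i - 1) (drop (Suc i) L)"
    let ?c = "normalized_color p (L ! i)"
    have fB: "f y = f (L ! i) \<longleftrightarrow> y \<in> {L ! i, L ! j}" if "y \<in> points p" for y
      using f[OF B _ that, of "L ! i"] by blast
    have "L ! j \<in> points p" using ij L(2) nth_mem by blast
    hence Lj: "F (L ! j) = inv_letter (F (L ! i))"
      using fB[of "L ! j"] neutral_block_opposite[OF pn B] by (simp add: F_def)
    note split = list_split_two[OF ij]
    have conj: "map F ?M = conjugate (?c, f (L ! i)) (map F ?N)"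
      unfolding split(1) by (simp add: conjugate_def Lj) (simp add: F_def)
    have t: "t = map F (take i L) @ conjugate (?c, f (L ! i)) (map F ?N) @ map F (drop (Suc j) L)"
      unfolding conj[symmetric] map_append[symmetric] t_def using split(2) by simp
    have L_split: "L = take i L @ (L ! i # ?N @ [L ! j]) @ drop (Suc j) L"
      using split by simp
    have "f (L ! i) \<noteq> f y" if "y \<in> set (take i L @ ?N @ drop (Suc j) L)" for y
    proof -
      have "y \<in> set L" using that by (subst L_split) auto
      hence "y \<in> points p" using L(2) by simp
      moreover have "distinct (take i L @ (L ! i # ?N @ [L ! j]) @ drop (Suc j) L)"
        using L(1) L_split by simp
      hence "y \<notin> {L ! i, L ! j}" using that by auto
      ultimately show ?thesis using fB by metis
    qed
    hence fresh: "f (L ! i) \<notin> snd ` set (map F (take i L) @ map F ?N @ map F (drop (Suc j) L))"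
      unfolding map_append[symmetric] by (force simp del: set_append map_append simp: F_def)
    have "height (map F ?M) = - color_sum p (set ?M)"
      unfolding F_def using L(1) by (intro height_map_points) simp
    hence height: "height (map F ?N) = - color_sum p (set ?M)"
      unfolding conj by (simp add: conjugate_def)
    have "int g dvd color_sum p (set ?M)"
    proof (cases "set ?M = points p")
      \<comment> \<open>A block consisting of the first and the last point encloses all points. This
        is not a proper subset, hence not a sector, but its color sum is 0 by neutrality.\<close>
      case True
      then show ?thesis using color_sum_points[OF pn] by simp
    next
      case False
      have nth: "cyclic_point p i m = drop i L ! m" if "m \<le> j - i" for m
        using that ij by (simp add: cyclic_point_def L_def)
      have "set ?M = (!) (drop i L) ` {0..<Suc (j - i)}"
        using ij by (intro nth_image[symmetric]) simp
      also have "\<dots> = cyclic_point p i ` {0..j - i}"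
        using nth by (intro image_cong) auto
      finally have M: "set ?M = cyclic_point p i ` {0..j - i}" .
      have "sector p (set ?M)"
        unfolding sector_def
      proof (intro conjI exI)
        have "set ?M \<subseteq> points p"
          using L(2) by (blast dest: in_set_takeD in_set_dropD)
        thus "set ?M \<subset> points p" using False by blast
        show "i < length (cyclic_order p)" "j - i < length (cyclic_order p)"
          using ij by (simp_all add: L_def)
        show "set ?M = cyclic_point p i ` {0..j - i}" by (rule M)
        show "{cyclic_point p i 0, cyclic_point p i (j - i)} \<in> blocks p"
          using nth[of 0] nth[of "j - i"] ij B by simp
      qed
      thus ?thesis by (rule sectors)
    qed
    hence "int g dvd height (map F ?N)" unfolding height by (simp only: dvd_minus_iff)
    with t fresh show ?thesis by blast
  qed
  have "row_relation C t []"
  proof (rule cong_Nil_if_balanced[OF g])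
    show "uniform Y" if "length Y = g" "fst ` set Y \<subseteq> {White}" for Y
      using uniform_of_fixed_exponent[of Y] that fixed by simp
    show "height t = 0"
      unfolding t_def F_def using height_map_points[OF L(1), of p f] L(2) color_sum_points[OF pn] by simp
    fix x assume "x \<in> snd ` set t"
    then obtain y where y: "y \<in> points p" "x = f y" using L(2) by (auto simp: t_def F_def)
    obtain B where B: "B \<in> blocks p" "y \<in> B" using partitions_obtain_block[OF part y(1)] .
    obtain a b where ab: "B = {a, b}" "normalized_color p a = White" "normalized_color p b = Black"
      using neutral_blockE[OF pn B(1)] .
    have "a \<in> set L" "b \<in> set L" using ab(1) partitions_block_subset[OF part B(1)] L(2) by auto
    then obtain i j where i: "i < length L" "a = L ! i" and j: "j < length L" "b = L ! j"
      by (metis in_set_conv_nth)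
    have "i \<noteq> j" using i j ab by auto
    have x: "f (L ! i) = x" "f (L ! j) = x"
      using f[OF B, of a] f[OF B, of b] partitions_block_subset[OF part B(1)]
      unfolding ab(1) i(2)[symmetric] j(2)[symmetric] y(2) by simp_all
    show "\<exists>\<alpha> \<beta> \<gamma> c. t = \<alpha> @ conjugate (c, x) \<beta> @ \<gamma> \<and>
           x \<notin> snd ` set (\<alpha> @ \<beta> @ \<gamma>) \<and> int g dvd height \<beta>"
    proof (cases "i < j")
      case True
      then show ?thesis using interval[of i j] x B(1) ab(1) i j by simp
    next
      case False
      then show ?thesis using interval[of j i] x B(1) ab(1) i j \<open>i \<noteq> j\<close> by (simp add: insert_commute)
    qed
  qed
  hence "row_relation C (cyclic_word p f) []" by (simp add: t_def L_def F_def[abs_def] cyclic_word_def)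
  then obtain q where q: "q \<in> C" "lower q = lower p" "upper q = upper p" "block_labelling q f"
    using cyclic_word_cong_Nil_iff[OF category] by blast
  have qn: "q \<in> neutral_pair_partitions" using q neutral by auto
  have qpart: "q \<in> partitions" by (rule neutral_partitions[OF qn])
  have points: "points q = points p" by (simp add: points_def q)
  have card: "card B = 2" if "B \<in> blocks r" "r \<in> neutral_pair_partitions" for B r
    using that by (auto simp: neutral_pair_partitions_def pair_partitions_def)
  \<comment> \<open>Since f separates the blocks of p, a block of q lies inside any block of p that
    it meets; both have two points.\<close>
  have same: "B = B'" if B: "B \<in> blocks q" and B': "B' \<in> blocks p" and x: "x \<in> B" "x \<in> B'" for B B' x
  proof (rule card_seteq)
    show "finite B'" using card[OF B' pn] by (simp add: card_ge_0_finite)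
    show "card B' \<le> card B" using card[OF B' pn] card[OF B qn] by simp
    show "B \<subseteq> B'"
    proof
      fix y assume "y \<in> B"
      hence "f y = f x" by (rule block_labellingD[OF q(4) B _ x(1)])
      moreover have "y \<in> points p"
        using \<open>y \<in> B\<close> partitions_block_subset[OF qpart B] points by auto
      ultimately show "y \<in> B'" using f[OF B' x(2), of y] by simp
    qed
  qed
  have nonempty: "\<exists>x. x \<in> B" if "B \<in> blocks r" "r \<in> neutral_pair_partitions" for B r
    using card[OF that] by (cases "B = {}") auto
  have "blocks q = blocks p"
  proof (intro equalityI subsetI)
    fix B assume B: "B \<in> blocks q"
    obtain x where x: "x \<in> B" using nonempty[OF B qn] by blast
    hence "x \<in> points p" using partitions_block_subset[OF qpart B] points by auto
    then obtain B' where "B' \<in> blocks p" "x \<in> B'" by (rule partitions_obtain_block[OF part])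
    thus "B \<in> blocks p" using same[OF B _ x] by simp
  next
    fix B' assume B': "B' \<in> blocks p"
    obtain x where x: "x \<in> B'" using nonempty[OF B' pn] by blast
    hence "x \<in> points q" using partitions_block_subset[OF part B'] points by auto
    then obtain B where "B \<in> blocks q" "x \<in> B" by (rule partitions_obtain_block[OF qpart])
    thus "B' \<in> blocks q" using same[OF _ B' _ x] by auto
  qed
  hence "q = p" using q by (intro tcpart.expand) simp
  thus "p \<in> C" using q by simp
qed

end

theorem theorem2:
  fixes C :: "tcpart set"
  assumes "category C"
    and "generated_category {} \<subseteq> C"
    and "C \<subseteq> generated_category {crossing}"
  shows "C \<subset> sector_category 0 \<or> (\<exists>w::nat. C = sector_category w)"
proof -
  interpret neutral_category C
    using assms(1,3) generated_category_crossing_subset by unfold_locales auto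
  \<comment> \<open>The letters 1 and 0 stand for any two distinct letters x and z.\<close>
  obtain g :: nat where g: "\<And>k. fixed_exponent 1 0 k \<longleftrightarrow> int g dvd k"
    using int_subgroup_generator[of "fixed_exponent 1 0"]
      fixed_exponent_0 fixed_exponent_add fixed_exponent_uminus by blast
  have sub: "C \<subseteq> sector_category g"
    using sector_fixed_exponent g neutral by (auto simp: sector_category_def)
  show ?thesis
  proof (cases "g = 0")
    \<comment> \<open>The inclusion in \<open>sector_category 0\<close> is proper or an equality;
      the latter is the second alternative with w = 0.\<close>
    case True
    then show ?thesis using sub by blast
  next
    case False
    then have "sector_category g \<subseteq> C" using g by (intro sector_category_subset) auto
    then show ?thesis using sub by blast
  qed
qed

end
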